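(* Let $\alpha\in(0,1)$. The function $$f_{\alpha}(x) = \mu_{1, - \alpha} \left( |x|^{\alpha - 1} \operatorname{sgn}(x) - |x - 1|^{\alpha - 1} \operatorname{sgn}(x - 1) \right),\quad x\in\mathbb{R}\setminus\{0,1\},$$ is such that $f_\alpha\in BV^\alpha(\mathbb{R})$ but $|f_\alpha|\notin BV^\alpha(\mathbb{R})$.
   Context: For an integer $n\ge 1$ and $\beta\in(-1,1)$ let $\mu_{n,\beta}=2^{\beta}\pi^{-n/2}\,\Gamma\left(\frac{n+\beta+1}{2}\right)/\Gamma\left(\frac{1-\beta}{2}\right)$ (so $\mu_{1,-\alpha}$ is this constant with $n=1$, $\beta=-\alpha$). For $\alpha\in(0,1)$ and $\varphi\in \mathrm{Lip}_c(\mathbb{R})$ (compactly supported Lipschitz), the fractional $\alpha$-divergence in dimension one is $$\mathrm{div}^\alpha\varphi(x)=\mu_{1,\alpha}\int_{\mathbb{R}}\frac{(y-x)(\varphi(y)-\varphi(x))}{|y-x|^{2+\alpha}}\,dy,\quad x\in\mathbb{R}.$$ For $f\in L^1(\mathbb{R})$ the fractional variation is $$|D^\alpha f|(\mathbb{R})=\sup\left\{\int_{\mathbb{R}} f\,\mathrm{div}^\alpha\varphi\,dx:\varphi\in C^\infty_c(\mathbb{R}),\ \|\varphi\|_{L^\infty(\mathbb{R})}\le1\right\},$$ and $BV^\alpha(\mathbb{R})=\{f\in L^1(\mathbb{R}):|D^\alpha f|(\mathbb{R})<+\infty\}$. *)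

theory Defs
  imports "HOL-Analysis.Analysis" "HOL-Probability.Essential_Supremum"
begin

definition frac_const :: "nat \<Rightarrow> real \<Rightarrow> real" where
  "frac_const n \<beta> =
     2 powr \<beta> * pi powr (- real n / 2) * Gamma ((real n + \<beta> + 1) / 2) / Gamma ((1 - \<beta>) / 2)"

text \<open>For compactly supported Lipschitz \<open>\<phi>\<close> and \<open>0 < \<alpha> < 1\<close> the integrand below is Lebesgue
  integrable, so the Bochner integral is not the default value. At \<open>y = x\<close> the integrand is
  \<open>0 / 0 = 0\<close>, on a null set.\<close>

definition frac_div :: "real \<Rightarrow> (real \<Rightarrow> real) \<Rightarrow> real \<Rightarrow> real" where
  "frac_div \<alpha> \<phi> x =
     frac_const 1 \<alpha> *
       (LINT y|lebesgue. (y - x) * (\<phi> y - \<phi> x) / (\<bar>y - x\<bar> powr (2 + \<alpha>)))"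

definition smooth_compact_support :: "(real \<Rightarrow> real) set" where
  "smooth_compact_support =
     {\<phi>. (\<forall>k x. (deriv ^^ k) \<phi> differentiable (at x)) \<and> compact (closure {x. \<phi> x \<noteq> 0})}"

text \<open>The supremum is taken in the extended reals, so that it always exists. For integrable \<open>f\<close>
  the pairing integrals converge, because \<open>frac_div \<alpha> \<phi>\<close> is bounded and continuous.\<close>

definition frac_variation :: "real \<Rightarrow> (real \<Rightarrow> real) \<Rightarrow> ereal" where
  "frac_variation \<alpha> f =
     (SUP \<phi>\<in>{\<phi> \<in> smooth_compact_support. esssup lebesgue (\<lambda>x. ereal \<bar>\<phi> x\<bar>) \<le> 1}.
        ereal (LINT x|lebesgue. f x * frac_div \<alpha> \<phi> x))"

text \<open>Membership is a property of representatives and depends only on the almost-everywhere class.\<close>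

definition BV_frac :: "real \<Rightarrow> (real \<Rightarrow> real) set" where
  "BV_frac \<alpha> = {f. integrable lebesgue f \<and> frac_variation \<alpha> f < \<infinity>}"

end

theory Submission
  imports Defs "HOL-Computational_Algebra.Polynomial"
begin

text \<open>Integrating by parts, the fractional divergence is \<open>\<mu> / \<alpha>\<close> times the convolution of
  \<open>\<phi>'\<close> with \<open>\<bar>x\<bar> powr (- \<alpha>)\<close>, so by Fubini the pairing of \<open>f\<close> with it is \<open>\<mu> / \<alpha>\<close> times the
  integral of \<open>\<phi>' * I f\<close>, where \<open>I f y\<close> is the integral of \<open>f x * \<bar>x - y\<bar> powr (- \<alpha>)\<close> over \<open>x\<close>.

  Let \<open>g x = \<bar>x\<bar> powr (\<alpha> - 1) * sgn x\<close>, so that \<open>f_\<alpha>\<close> is a multiple of \<open>g x - g (x - 1)\<close>. As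
  \<open>g\<close> is odd and \<open>I g\<close> is formally homogeneous of degree 0, differences \<open>I g y - I g z\<close> vanish whenever
  \<open>y\<close> and \<open>z\<close> have the same sign. Hence \<open>I f_\<alpha>\<close> is constant on each of the three intervals cut out by 0 and 1,
  and the pairing is a linear combination of \<open>\<phi> 0\<close> and \<open>\<phi> 1\<close>.

  For \<open>\<bar>f_\<alpha>\<bar>\<close> there is no cancellation: \<open>I \<bar>f_\<alpha>\<bar> y\<close> is at least a multiple of \<open>ln (1 / y)\<close> as \<open>y\<close> decreases to 0. Test
  functions rising from 0 to 1 closer and closer to 0 make the pairing unbounded.\<close>

section \<open>Integrability of powers\<close>

lemma has_real_derivative_abs_powr:
  fixes x p :: real
  assumes "x \<noteq> 0"
  shows "((\<lambda>x. \<bar>x\<bar> powr p) has_real_derivative p * \<bar>x\<bar> powr (p - 1) * sgn x) (at x)"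
proof -
  have "((\<lambda>x. \<bar>x\<bar>) has_real_derivative sgn x) (at x)"
  proof (cases "x > 0")
    case True
    show ?thesis
      by (rule has_field_derivative_transform_within_open[OF _ open_greaterThan[of 0], where f = "\<lambda>x. x"])
        (use True in simp_all)
  next
    case False
    show ?thesis
      by (rule has_field_derivative_transform_within_open[OF _ open_lessThan[of 0], where f = "\<lambda>x. - x"])
        (use False assms in \<open>auto intro!: derivative_eq_intros\<close>)
  qed
  from DERIV_fun_powr[OF this, of p] assms show ?thesis
    by (simp add: mult_ac)
qed

text \<open>The half-line part of \<open>h\<close> and its reflection together dominate
  \<open>h\<close>. The hypothesis lives on \<open>lebesgue\<close>, where the known integrals of
  powers over half lines land; Borel measurability brings the conclusion to
  \<open>lborel\<close>.\<close>

lemma integrable_lborel_abs_even: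
  fixes h :: "real \<Rightarrow> real"
  assumes [measurable]: "h \<in> borel_measurable borel"
    and "(\<lambda>x. indicator {0..} x * h x) absolutely_integrable_on UNIV"
    and "\<And>x. h (- x) = h x"
  shows "integrable lborel h"
proof -
  have 1: "integrable lborel (\<lambda>x. indicator {0..} x * h x)"
    using assms(2) by (subst (asm) set_integrable_def) (simp add: integrable_completion)
  have 2: "integrable lborel (\<lambda>x. indicator {0..} (-x) * h (-x))"
    using lborel_integrable_real_affine[OF 1, of "-1" 0] by simp
  show ?thesis
    by (rule Bochner_Integration.integrable_bound[OF Bochner_Integration.integrable_add[OF
          integrable_norm[OF 1] integrable_norm[OF 2]]])
      (auto simp: indicator_def assms(3))
qed

lemma integrable_abs_powr_near_0:
  fixes p :: real
  assumes "- 1 < p"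
  shows "integrable lborel (\<lambda>x::real. indicator {-1..1} x * \<bar>x\<bar> powr p)"
proof (rule integrable_lborel_abs_even)
  have "(\<lambda>x::real. x powr p) absolutely_integrable_on {0..1}"
    by (rule nonnegative_absolutely_integrable_1[OF integrable_on_powr_from_0]) (use assms in auto)
  then have "(\<lambda>x::real. indicator {0..1} x * x powr p) absolutely_integrable_on UNIV"
    by (simp add: set_integrable_def)
  moreover have "indicator {0..1} x * x powr p = indicator {0..} x * (indicator {-1..1} x * \<bar>x\<bar> powr p)"
    for x :: real by (auto simp: indicator_def)
  ultimately show "(\<lambda>x::real. indicator {0..} x * (indicator {-1..1} x * \<bar>x\<bar> powr p))
      absolutely_integrable_on UNIV" by simp
qed (auto simp: indicator_def)

lemma integrable_abs_powr_at_infinity: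
  fixes p :: real
  assumes "p < - 1"
  shows "integrable lborel (\<lambda>x::real. indicator (- {-1<..<1}) x * \<bar>x\<bar> powr p)"
proof (rule integrable_lborel_abs_even)
  have "(\<lambda>x::real. x powr p) integrable_on {1..}"
    using has_integral_powr_to_inf[OF assms, of 1] by (auto simp: integrable_on_def)
  then have "(\<lambda>x::real. x powr p) absolutely_integrable_on {1..}"
    by (rule nonnegative_absolutely_integrable_1) auto
  then have "(\<lambda>x::real. indicator {1..} x * x powr p) absolutely_integrable_on UNIV"
    by (simp add: set_integrable_def)
  moreover have "indicator {1..} x * x powr p = indicator {0..} x * (indicator (- {-1<..<1}) x * \<bar>x\<bar> powr p)"
    for x :: real by (auto simp: indicator_def)
  ultimately show "(\<lambda>x::real. indicator {0..} x * (indicator (- {-1<..<1}) x * \<bar>x\<bar> powr p))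
      absolutely_integrable_on UNIV" by simp
qed (auto simp: indicator_def)

lemma integrable_indicator_Icc: "integrable lborel (indicator {a..b} :: real \<Rightarrow> real)"
  by (rule integrable_real_indicator) (auto simp: emeasure_lborel_Icc_eq)

lemma abs_powr_le_1:
  fixes t p :: real
  assumes "1 < \<bar>t\<bar>" "p \<le> 0"
  shows "\<bar>t\<bar> powr p \<le> 1"
proof -
  have "\<bar>t\<bar> powr p \<le> \<bar>t\<bar> powr 0"
    using assms by (intro powr_mono) auto
  also have "\<dots> = 1" using assms by (subst powr_zero_eq_one) auto
  finally show ?thesis .
qed

text \<open>Within distance 1 of \<open>a\<close> the translated integrable singularity dominates;
  farther away the power is at most 1, since \<open>p \<le> 0\<close>, and the indicator of the
  interval takes over.\<close>

lemma integrable_abs_diff_powr_Icc: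
  fixes p a c d :: real
  assumes "- 1 < p" "p \<le> 0"
  shows "integrable lborel (\<lambda>x. indicator {c..d} x * \<bar>x - a\<bar> powr p)"
proof -
  have 1: "integrable lborel (\<lambda>x. indicator {-1..1} (x - a) * \<bar>x - a\<bar> powr p)"
    using lborel_integrable_real_affine[OF integrable_abs_powr_near_0[OF assms(1)], of 1 "- a"]
    by simp
  show ?thesis
  proof (rule Bochner_Integration.integrable_bound[OF Bochner_Integration.integrable_add[OF 1
          integrable_indicator_Icc[of c d]]])
    show "AE x in lborel. norm (indicator {c..d} x * \<bar>x - a\<bar> powr p)
        \<le> norm (indicator {-1..1} (x - a) * \<bar>x - a\<bar> powr p + indicator {c..d} x)"
    proof (intro AE_I2)
      fix x :: real
      have "\<bar>x - a\<bar> powr p \<le> 1" if "\<bar>x - a\<bar> > 1"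
        using that assms by (intro abs_powr_le_1)
      then show "norm (indicator {c..d} x * \<bar>x - a\<bar> powr p)
        \<le> norm (indicator {-1..1} (x - a) * \<bar>x - a\<bar> powr p + indicator {c..d} x)"
        by (cases "\<bar>x - a\<bar> > 1"; cases "x \<in> {c..d}") (auto simp: indicator_def)
    qed
  qed simp
qed

text \<open>Fundamental theorem on \<open>{-n..n}\<close>, then dominated convergence with majorant
  \<open>norm (h x)\<close>. The finite set \<open>S\<close> admits a point where \<open>F\<close>
  is only continuous, which permits integration by parts across a singularity.\<close>

lemma integral_derivative_eq_0:
  fixes F h :: "real \<Rightarrow> real"
  assumes h: "integrable lborel h"
    and "finite S" "continuous_on UNIV F"
    and "\<And>x. x \<notin> S \<Longrightarrow> (F has_real_derivative h x) (at x)"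
    and lim: "(F \<longlongrightarrow> 0) at_top" "(F \<longlongrightarrow> 0) at_bot"
  shows "(LINT x|lborel. h x) = 0"
proof -
  have eq: "(LINT x|lborel. indicator {- real n..real n} x * h x) = F (real n) - F (- real n)" for n
  proof -
    have "(h has_integral (F (real n) - F (- real n))) {- real n..real n}"
      by (rule fundamental_theorem_of_calculus_interior_strong[OF \<open>finite S\<close>])
        (use assms in \<open>auto simp: has_real_derivative_iff_has_vector_derivative[symmetric]
          intro: continuous_on_subset\<close>)
    moreover have "set_integrable lborel {- real n..real n} h"
      unfolding set_integrable_def using h by (intro integrable_mult_indicator) auto
    then have "(LINT x:{- real n..real n}|lborel. h x) = integral {- real n..real n} h"
      by (rule set_borel_integral_eq_integral)
    ultimately show ?thesis
      by (auto simp: set_lebesgue_integral_def dest: integral_unique)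
  qed
  have "(\<lambda>n. LINT x|lborel. indicator {- real n..real n} x * h x) \<longlonglongrightarrow> (LINT x|lborel. h x)"
  proof (rule integral_dominated_convergence[where w = "\<lambda>x. norm (h x)"])
    show "AE x in lborel. (\<lambda>n. indicator {- real n..real n} x * h x) \<longlonglongrightarrow> h x"
    proof (intro AE_I2 tendsto_eventually)
      fix x :: real
      obtain N :: nat where "\<bar>x\<bar> \<le> real N" using real_arch_simple by blast
      then show "\<forall>\<^sub>F n in sequentially. indicator {- real n..real n} x * h x = h x"
        by (intro eventually_sequentiallyI[of N]) (auto simp: indicator_def abs_le_iff)
    qed
  qed (use h in \<open>auto simp: indicator_def\<close>)
  moreover have "(\<lambda>n. F (real n) - F (- real n)) \<longlonglongrightarrow> 0 - 0"
    by (intro tendsto_diff filterlim_compose[OF lim(1)] filterlim_compose[OF lim(2)]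
        filterlim_real_sequentially filterlim_uminus_at_bot_at_top[THEN filterlim_compose])
  ultimately show ?thesis
    unfolding eq by (simp add: LIMSEQ_unique)
qed

section \<open>Riesz integrals and the fractional divergence\<close>

text \<open>Up to normalization, the Riesz potential of order 1 - \<alpha>. It takes the default
  value 0 where the integrand is not integrable, so identities for it are claimed almost everywhere
  or under explicit integrability.\<close>

definition riesz_integral :: "real \<Rightarrow> (real \<Rightarrow> real) \<Rightarrow> real \<Rightarrow> real" where
  "riesz_integral \<alpha> f y = (LINT x|lborel. f x * \<bar>x - y\<bar> powr (- \<alpha>))"

text \<open>Near \<open>x\<close> the kernel is a translate of a fixed integrable function;
  elsewhere it is at most 1 on an interval of length \<open>2 * R\<close>. The resulting bound does
  not depend on \<open>x\<close>, which is what the Fubini argument requires.\<close>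

lemma riesz_kernel_Icc:
  fixes \<alpha> x :: real and \<psi> :: "real \<Rightarrow> real"
  assumes \<alpha>: "0 < \<alpha>" "\<alpha> < 1" and \<psi>_borel [measurable]: "\<psi> \<in> borel_measurable borel"
    and LR: "0 \<le> L" "0 \<le> R" and \<psi>: "\<And>y. \<bar>\<psi> y\<bar> \<le> L * indicator {-R..R} y"
  shows "integrable lborel (\<lambda>y. \<bar>x - y\<bar> powr (- \<alpha>) * \<psi> y)" (is ?int)
    and "(LINT y|lborel. \<bar>\<bar>x - y\<bar> powr (- \<alpha>) * \<psi> y\<bar>)
      \<le> L * ((LINT t|lborel. indicator {-1..1} t * \<bar>t\<bar> powr (- \<alpha>)) + 2 * R)"
proof -
  let ?k = "\<lambda>t::real. indicator {-1..1} t * \<bar>t\<bar> powr (- \<alpha>) :: real"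
  have k: "integrable lborel ?k"
    using \<alpha> by (intro integrable_abs_powr_near_0) auto
  define w where "w = (\<lambda>y. L * (?k (y - x) + indicator {-R..R} y))"
  have k': "integrable lborel (\<lambda>y. ?k (y - x))" "(LINT y|lborel. ?k (y - x)) = integral\<^sup>L lborel ?k"
    using lborel_integrable_real_affine[OF k, of 1 "- x"] lborel_integral_real_affine[of 1 ?k "- x"]
    by simp_all
  have w: "integrable lborel w"
    unfolding w_def by (intro integrable_mult_right Bochner_Integration.integrable_add k' integrable_indicator_Icc)
  have bound: "\<bar>\<bar>x - y\<bar> powr (- \<alpha>) * \<psi> y\<bar> \<le> w y" for y
  proof -
    have "\<bar>x - y\<bar> powr (- \<alpha>) \<le> 1" if "\<bar>x - y\<bar> > 1"
      using that \<alpha> by (intro abs_powr_le_1) auto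
    then have "\<bar>x - y\<bar> powr (- \<alpha>) * indicator {-R..R} y \<le> ?k (y - x) + indicator {-R..R} y"
      by (auto simp: indicator_def abs_minus_commute)
    then have "L * (\<bar>x - y\<bar> powr (- \<alpha>) * indicator {-R..R} y) \<le> w y"
      unfolding w_def using LR by (intro mult_left_mono)
    moreover have "\<bar>\<bar>x - y\<bar> powr (- \<alpha>) * \<psi> y\<bar> \<le> \<bar>x - y\<bar> powr (- \<alpha>) * (L * indicator {-R..R} y)"
      using \<psi>[of y] by (simp add: abs_mult mult_left_mono)
    ultimately show ?thesis by (simp add: mult_ac)
  qed
  show int: ?int
    by (rule Bochner_Integration.integrable_bound[OF w]) (use bound in \<open>auto intro!: AE_I2 order_trans[OF bound]\<close>)
  have "(LINT y|lborel. \<bar>\<bar>x - y\<bar> powr (- \<alpha>) * \<psi> y\<bar>) \<le> integral\<^sup>L lborel w"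
    by (intro integral_mono integrable_abs int w bound)
  also have "\<dots> = L * (integral\<^sup>L lborel ?k + 2 * R)"
    unfolding w_def using LR k' by simp
  finally show "(LINT y|lborel. \<bar>\<bar>x - y\<bar> powr (- \<alpha>) * \<psi> y\<bar>) \<le> L * (integral\<^sup>L lborel ?k + 2 * R)" .
qed

text \<open>Integrating the absolute value over \<open>y\<close> first leaves at most a constant
  multiple of \<open>\<bar>f x\<bar>\<close>, by the uniform kernel bound.\<close>

lemma integrable_riesz_product:
  fixes \<alpha> :: real and f \<psi> :: "real \<Rightarrow> real"
  assumes \<alpha>: "0 < \<alpha>" "\<alpha> < 1" and f: "integrable lborel f"
    and \<psi>[measurable]: "\<psi> \<in> borel_measurable borel" "0 \<le> L" "0 \<le> R"
    "\<And>y. \<bar>\<psi> y\<bar> \<le> L * indicator {-R..R} y"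
  shows "integrable (lborel \<Otimes>\<^sub>M lborel) (\<lambda>(x, y). f x * \<bar>x - y\<bar> powr (- \<alpha>) * \<psi> y)"
proof -
  have [measurable]: "f \<in> borel_measurable borel"
    using borel_measurable_integrable[OF f] by simp
  define D where "D = (LINT t|lborel. indicator {-1..1} t * \<bar>t\<bar> powr (- \<alpha>))"
  note D = riesz_kernel_Icc[OF \<alpha> \<psi>, folded D_def]
  show ?thesis
  proof (rule lborel_pair.Fubini_integrable)
    show "integrable lborel (\<lambda>x. LINT y|lborel. norm (case (x, y) of (x, y) \<Rightarrow> f x * \<bar>x - y\<bar> powr (- \<alpha>) * \<psi> y))"
    proof (rule Bochner_Integration.integrable_bound[OF integrable_mult_right[OF f, of "L * (D + 2 * R)"]])
      show "AE x in lborel. norm (LINT y|lborel. norm (case (x, y) of (x, y) \<Rightarrow> f x * \<bar>x - y\<bar> powr (- \<alpha>) * \<psi> y))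
          \<le> norm (L * (D + 2 * R) * f x)"
      proof (intro AE_I2)
        fix x
        have "(LINT y|lborel. norm (f x * \<bar>x - y\<bar> powr (- \<alpha>) * \<psi> y))
          = \<bar>f x\<bar> * (LINT y|lborel. \<bar>\<bar>x - y\<bar> powr (- \<alpha>) * \<psi> y\<bar>)"
          by (simp add: abs_mult mult.assoc flip: integral_mult_right_zero)
        moreover have "\<bar>f x\<bar> * (LINT y|lborel. \<bar>\<bar>x - y\<bar> powr (- \<alpha>) * \<psi> y\<bar>) \<le> \<bar>f x\<bar> * \<bar>L * (D + 2 * R)\<bar>"
          by (intro mult_left_mono order_trans[OF D(2) abs_ge_self]) auto
        ultimately show "norm (LINT y|lborel. norm (case (x, y) of (x, y) \<Rightarrow> f x * \<bar>x - y\<bar> powr (- \<alpha>) * \<psi> y))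
          \<le> norm (L * (D + 2 * R) * f x)"
          by (simp add: abs_mult mult_ac)
      qed
    qed measurable
    show "AE x in lborel. integrable lborel (\<lambda>y. case (x, y) of (x, y) \<Rightarrow> f x * \<bar>x - y\<bar> powr (- \<alpha>) * \<psi> y)"
      using D(1) by (intro AE_I2) (simp add: mult.assoc)
  qed measurable
qed

lemma integrable_riesz_mult:
  fixes \<alpha> :: real and f \<psi> :: "real \<Rightarrow> real"
  assumes "0 < \<alpha>" "\<alpha> < 1" "integrable lborel f" "\<psi> \<in> borel_measurable borel" "0 \<le> L" "0 \<le> R"
    "\<And>y. \<bar>\<psi> y\<bar> \<le> L * indicator {-R..R} y"
  shows "integrable lborel (\<lambda>y. riesz_integral \<alpha> f y * \<psi> y)"
proof -
  have "integrable lborel (\<lambda>y. LINT x|lborel. f x * \<bar>x - y\<bar> powr (- \<alpha>) * \<psi> y)"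
    using integrable_riesz_product[OF assms] by (rule lborel_pair.integrable_snd)
  then show ?thesis
    by (simp only: riesz_integral_def integral_mult_left_zero)
qed

text \<open>Fubini with the indicator of \<open>{-n..n}\<close> in place of \<psi> gives the claim
  for almost every \<open>y\<close> in that interval; countably many \<open>n\<close> exhaust the
  line.\<close>

lemma AE_integrable_riesz:
  fixes \<alpha> :: real and f :: "real \<Rightarrow> real"
  assumes \<alpha>: "0 < \<alpha>" "\<alpha> < 1" and f: "integrable lborel f"
  shows "AE y in lborel. integrable lborel (\<lambda>x. f x * \<bar>x - y\<bar> powr (- \<alpha>))"
proof -
  have "AE y in lborel. integrable lborel (\<lambda>x. f x * \<bar>x - y\<bar> powr (- \<alpha>) * indicator {- real n..real n} y)" for n
    by (rule lborel_pair.AE_integrable_snd[OF integrable_riesz_product[OF \<alpha> f, of _ 1 "real n"]]) auto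
  then have "AE y in lborel. \<forall>n. integrable lborel (\<lambda>x. f x * \<bar>x - y\<bar> powr (- \<alpha>) * indicator {- real n..real n} y)"
    by (rule AE_all_countable[THEN iffD2, OF allI])
  then show ?thesis
  proof eventually_elim
    case (elim y)
    obtain n where "\<bar>y\<bar> \<le> real n" using real_arch_simple by blast
    then have "indicator {- real n..real n} y = (1::real)" by (auto simp: indicator_def)
    with elim[rule_format, of n] show ?case by simp
  qed
qed

text \<open>Only one continuous derivative and a support radius of a test function enter the pairing
  formula. The same formula then serves arbitrary test functions and the explicit spikes.\<close>

locale C1_compact =
  fixes \<phi> \<phi>' :: "real \<Rightarrow> real" and R :: real
  assumes deriv: "\<And>x. (\<phi> has_real_derivative \<phi>' x) (at x)"
    and cont: "continuous_on UNIV \<phi>'"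
    and R: "0 \<le> R"
    and supp: "\<And>x. R < \<bar>x\<bar> \<Longrightarrow> \<phi> x = 0"
begin

lemma deriv_supp: "\<phi>' x = 0" if "R < \<bar>x\<bar>"
proof -
  have "open {x. R < \<bar>x\<bar>}" by (intro open_Collect_less continuous_intros)
  then have "((\<lambda>_. 0) has_real_derivative \<phi>' x) (at x)"
    by (rule has_field_derivative_transform_within_open[OF deriv]) (use that supp in auto)
  then show ?thesis using DERIV_const DERIV_unique by blast
qed

lemma cont_\<phi>: "continuous_on UNIV \<phi>"
  using DERIV_isCont[OF deriv] by (simp add: continuous_at_imp_continuous_on)

lemma measurable_C1 [measurable]:
  "\<phi> \<in> borel_measurable borel" "\<phi>' \<in> borel_measurable borel"
  using cont cont_\<phi> by (auto intro: borel_measurable_continuous_onI)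

text \<open>The bound on \<open>\<phi>'\<close> feeds the kernel estimates, the Lipschitz bound
  tames the singularity of the fractional divergence, and the bound on \<phi> controls its
  tails.\<close>

lemma bounds:
  obtains L where "0 \<le> L" "\<And>y. \<bar>\<phi>' y\<bar> \<le> L * indicator {-R..R} y"
    "\<And>x y. \<bar>\<phi> y - \<phi> x\<bar> \<le> L * \<bar>y - x\<bar>" "\<And>x. \<bar>\<phi> x\<bar> \<le> L"
proof -
  have "compact (\<phi>' ` {-R..R})" "compact (\<phi> ` {-R..R})"
    using cont cont_\<phi> by (auto intro!: compact_continuous_image intro: continuous_on_subset)
  then have "bounded (\<phi>' ` {-R..R})" "bounded (\<phi> ` {-R..R})"
    by (auto dest: compact_imp_bounded)
  then obtain B B' where B: "\<And>y. y \<in> {-R..R} \<Longrightarrow> \<bar>\<phi>' y\<bar> \<le> B" "\<And>y. y \<in> {-R..R} \<Longrightarrow> \<bar>\<phi> y\<bar> \<le> B'"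
    unfolding bounded_real by blast
  define L where "L = max 0 (max B B')"
  have 1: "\<bar>\<phi>' y\<bar> \<le> L * indicator {-R..R} y" for y
    using B(1)[of y] deriv_supp[of y] by (auto simp: L_def indicator_def)
  have "\<bar>\<phi> y\<bar> \<le> L" for y
  proof (cases "R < \<bar>y\<bar>")
    case False
    then have "y \<in> {-R..R}" by auto
    from B(2)[OF this] show ?thesis by (simp add: L_def le_max_iff_disj)
  qed (simp add: supp L_def)
  moreover have "\<bar>\<phi> y - \<phi> x\<bar> \<le> L * \<bar>y - x\<bar>" for x y
  proof -
    have "\<bar>\<phi>' y\<bar> \<le> L" for y using 1[of y] by (cases "y \<in> {-R..R}") (auto simp: L_def)
    then show ?thesis
      using field_differentiable_bound[of UNIV \<phi> \<phi>' L y x] deriv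
      by (simp add: has_field_derivative_at_within)
  qed
  ultimately show ?thesis using that[of L] 1 by (simp add: L_def)
qed

lemma integrable_\<phi>': "integrable lborel \<phi>'"
proof -
  obtain L where "\<And>y. \<bar>\<phi>' y\<bar> \<le> L * indicator {-R..R} y" using bounds by metis
  then show ?thesis
    by (intro Bochner_Integration.integrable_bound[OF integrable_mult_right[OF integrable_indicator_Icc[of "-R" R], of L]])
      (auto intro!: AE_I2 order_trans[OF _ abs_ge_self])
qed

end

section \<open>The fractional divergence as a convolution, and its pairing with integrable
  functions\<close>

context C1_compact
begin

text \<open>Integration by parts without boundary terms: \<open>F\<close> tends to 0 at infinity
  because \<alpha> > 0, and is continuous through \<open>x\<close> because \<phi> is Lipschitz and
  \<alpha> < 1.\<close>

lemma frac_div_eq: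
  fixes \<alpha> :: real
  assumes \<alpha>: "0 < \<alpha>" "\<alpha> < 1"
  shows "frac_div \<alpha> \<phi> x = frac_const 1 \<alpha> / \<alpha> * (LINT y|lborel. \<bar>x - y\<bar> powr (- \<alpha>) * \<phi>' y)"
proof -
  obtain L where L: "0 \<le> L" "\<And>y. \<bar>\<phi>' y\<bar> \<le> L * indicator {-R..R} y"
    "\<And>x y. \<bar>\<phi> y - \<phi> x\<bar> \<le> L * \<bar>y - x\<bar>" "\<And>x. \<bar>\<phi> x\<bar> \<le> L"
    using bounds by blast
  define h where "h y = (y - x) * (\<phi> y - \<phi> x) / \<bar>y - x\<bar> powr (2 + \<alpha>)" for y
  \<comment> \<open>a primitive of \<open>h y - \<bar>x - y\<bar> powr (- \<alpha>) * \<phi>' y / \<alpha>\<close> away from \<open>x\<close>, vanishing at infinity and at \<open>x\<close>\<close>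
  define F where "F y = - (\<bar>y - x\<bar> powr (- \<alpha>) * (\<phi> y - \<phi> x)) / \<alpha>" for y
  let ?k = "\<lambda>y. \<bar>x - y\<bar> powr (- \<alpha>) * \<phi>' y"
  have k: "integrable lborel ?k"
    using riesz_kernel_Icc(1)[OF \<alpha> _ L(1) R L(2)] by simp
  have [measurable]: "h \<in> borel_measurable borel"
    unfolding h_def by measurable
  \<comment> \<open>The quotient becomes a single signed power, the form in which it appears in the
    derivative of \<open>F\<close>. Both sides are 0 at \<open>y = x\<close>.\<close>
  have h_eq: "h y = sgn (y - x) * \<bar>y - x\<bar> powr (- \<alpha> - 1) * (\<phi> y - \<phi> x)" for y
  proof (cases "y = x")
    case False
    define P where "P = \<bar>y - x\<bar> powr (- \<alpha> - 1)"
    have "\<bar>y - x\<bar> powr (2 + \<alpha>) * P = \<bar>y - x\<bar>" "P \<noteq> 0" "\<bar>y - x\<bar> powr (2 + \<alpha>) \<noteq> 0"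
      using False by (simp_all add: P_def flip: powr_add)
    moreover have "y - x = sgn (y - x) * \<bar>y - x\<bar>"
      by (simp add: mult_sgn_abs)
    ultimately have "(y - x) / \<bar>y - x\<bar> powr (2 + \<alpha>) = sgn (y - x) * P"
      by (metis nonzero_mult_div_cancel_left times_divide_eq_right)
    then show ?thesis
      unfolding h_def P_def[symmetric] by (simp flip: times_divide_eq_left)
  qed (simp add: h_def)
  \<comment> \<open>Near \<open>x\<close> the Lipschitz bound gains one power, leaving the exponent
    -\<alpha> > -1; far away the increment of \<phi> is at most \<open>2 * L\<close> and the
    exponent -\<alpha> - 1 < -1 is integrable.\<close>
  let ?w = "\<lambda>t::real. L * (indicator {-1..1} t * \<bar>t\<bar> powr (- \<alpha>)) + 2 * L * (indicator (- {-1<..<1}) t * \<bar>t\<bar> powr (- \<alpha> - 1))"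
  have w: "integrable lborel ?w"
    using \<alpha> by (intro Bochner_Integration.integrable_add integrable_mult_right
        integrable_abs_powr_near_0 integrable_abs_powr_at_infinity) auto
  have h_bound: "\<bar>h y\<bar> \<le> ?w (y - x)" for y
  proof (cases "\<bar>y - x\<bar> \<le> 1")
    case True
    show ?thesis
    proof (cases "y = x")
      case False
      have "\<bar>h y\<bar> \<le> \<bar>y - x\<bar> powr (- \<alpha> - 1) * (L * \<bar>y - x\<bar>)"
        unfolding h_eq abs_mult using L(3)[where x = x and y = y] False by (auto intro!: mult_mono simp: abs_sgn_eq)
      also have "\<dots> = L * \<bar>y - x\<bar> powr (- \<alpha>)"
        using powr_mult_base[of "\<bar>y - x\<bar>" "- \<alpha> - 1"] by (simp add: mult_ac)
      also have "\<dots> \<le> ?w (y - x)" using True L(1) by (auto simp: indicator_def abs_le_iff)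
      finally show ?thesis .
    qed (use L(1) in \<open>simp add: h_eq\<close>)
  next
    case False
    have "\<bar>\<phi> y - \<phi> x\<bar> \<le> 2 * L" using L(4)[of x] L(4)[of y] by linarith
    then have "\<bar>h y\<bar> \<le> \<bar>y - x\<bar> powr (- \<alpha> - 1) * (2 * L)"
      unfolding h_eq abs_mult by (auto intro!: mult_mono simp: abs_sgn_eq)
    also have "\<dots> \<le> ?w (y - x)" using False L(1) by (auto simp: indicator_def abs_le_iff)
    finally show ?thesis .
  qed
  have h: "integrable lborel h"
    using h_bound by (intro Bochner_Integration.integrable_bound[OF lborel_integrable_real_affine[OF w, of 1 "- x"]])
      (auto intro!: AE_I2 order_trans[OF _ abs_ge_self])
  have "(LINT y|lborel. h y - ?k y / \<alpha>) = 0"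
  proof (rule integral_derivative_eq_0[where S = "{x}" and F = F])
    show "integrable lborel (\<lambda>y. h y - ?k y / \<alpha>)" using h k by auto
    show "(F has_real_derivative h y - ?k y / \<alpha>) (at y)" if "y \<notin> {x}" for y
    proof -
      have "((\<lambda>y. \<bar>y - x\<bar> powr (- \<alpha>)) has_real_derivative
          - \<alpha> * \<bar>y - x\<bar> powr (- \<alpha> - 1) * sgn (y - x) * 1) (at y)"
        by (rule DERIV_chain2[OF has_real_derivative_abs_powr])
          (use that in \<open>auto intro!: derivative_eq_intros\<close>)
      from DERIV_cdivide[OF DERIV_minus[OF DERIV_mult[OF this DERIV_diff[OF deriv DERIV_const]]]]
      have "(F has_real_derivative - ((- \<alpha> * \<bar>y - x\<bar> powr (- \<alpha> - 1) * sgn (y - x) * 1) * (\<phi> y - \<phi> x)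
          + (\<phi>' y - 0) * \<bar>y - x\<bar> powr (- \<alpha>)) / \<alpha>) (at y)"
        unfolding F_def .
      then show ?thesis
        unfolding h_eq by (rule DERIV_cong) (use \<alpha> in \<open>simp add: field_simps abs_minus_commute\<close>)
    qed
    \<comment> \<open>The Lipschitz bound leaves the positive exponent 1 - \<alpha>, hence
      continuity of \<open>F\<close> at \<open>x\<close>. The cruder \<open>F_bound'\<close> below
      keeps the exponent -\<alpha>, hence decay at infinity.\<close>
    have F_bound: "\<bar>F y\<bar> \<le> L / \<alpha> * \<bar>y - x\<bar> powr (1 - \<alpha>)" for y
    proof -
      have "\<bar>F y\<bar> = \<bar>y - x\<bar> powr (- \<alpha>) * \<bar>\<phi> y - \<phi> x\<bar> / \<alpha>"
        using \<alpha> by (simp add: F_def abs_mult)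
      also have "\<dots> \<le> \<bar>y - x\<bar> powr (- \<alpha>) * (L * \<bar>y - x\<bar>) / \<alpha>"
        using L(3)[where x = x and y = y] \<alpha> by (intro divide_right_mono mult_left_mono) auto
      also have "\<dots> = L / \<alpha> * \<bar>y - x\<bar> powr (1 - \<alpha>)"
        using powr_mult_base[of "\<bar>y - x\<bar>" "- \<alpha>"] by (simp add: mult_ac)
      finally show ?thesis .
    qed
    have "isCont F y" for y
    proof (cases "y = x")
      case True
      have "((\<lambda>y. L / \<alpha> * \<bar>y - x\<bar> powr (1 - \<alpha>)) \<longlongrightarrow> L / \<alpha> * \<bar>x - x\<bar> powr (1 - \<alpha>)) (at x)"
        using \<alpha> by (intro tendsto_intros) auto
      then have "((\<lambda>y. L / \<alpha> * \<bar>y - x\<bar> powr (1 - \<alpha>)) \<longlongrightarrow> 0) (at x)"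
        by simp
      then have "(F \<longlongrightarrow> 0) (at x)"
        by (rule Lim_null_comparison[rotated]) (use F_bound in \<open>auto intro!: always_eventually\<close>)
      then show ?thesis using True by (simp add: isCont_def F_def)
    next
      case False
      show ?thesis unfolding F_def
        using False cont_\<phi> \<alpha> by (auto intro!: continuous_intros simp: continuous_on_eq_continuous_at)
    qed
    then show "continuous_on UNIV F" by (simp add: continuous_at_imp_continuous_on)
    have F_bound': "\<bar>F y\<bar> \<le> 2 * L / \<alpha> * \<bar>y - x\<bar> powr (- \<alpha>)" for y
    proof -
      have "\<bar>F y\<bar> = \<bar>y - x\<bar> powr (- \<alpha>) * \<bar>\<phi> y - \<phi> x\<bar> / \<alpha>"
        using \<alpha> by (simp add: F_def abs_mult)
      also have "\<dots> \<le> \<bar>y - x\<bar> powr (- \<alpha>) * (2 * L) / \<alpha>"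
        using L(4)[of x] L(4)[of y] \<alpha> by (intro divide_right_mono mult_left_mono) (linarith | simp)+
      finally show ?thesis by (simp add: mult_ac)
    qed
    have decay: "(F \<longlongrightarrow> 0) G" if "filterlim (\<lambda>y. \<bar>y - x\<bar>) at_top G" for G
    proof (rule Lim_null_comparison)
      show "\<forall>\<^sub>F y in G. norm (F y) \<le> 2 * L / \<alpha> * \<bar>y - x\<bar> powr (- \<alpha>)"
        using F_bound' by (intro always_eventually) simp
      have "((\<lambda>y. \<bar>y - x\<bar> powr (- \<alpha>)) \<longlongrightarrow> 0) G"
        using \<alpha> that by (intro tendsto_neg_powr) auto
      then show "((\<lambda>y. 2 * L / \<alpha> * \<bar>y - x\<bar> powr (- \<alpha>)) \<longlongrightarrow> 0) G"
        by (rule tendsto_mult_right_zero)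
    qed
    have "filterlim (\<lambda>y. \<bar>y - x\<bar>) at_top at_top" "filterlim (\<lambda>y. \<bar>y - x\<bar>) at_top at_bot"
      by real_asymp+
    then show "(F \<longlongrightarrow> 0) at_top" "(F \<longlongrightarrow> 0) at_bot"
      by (auto intro: decay)
  qed simp
  then have "integral\<^sup>L lborel h = (LINT y|lborel. ?k y) / \<alpha>"
    using h k by simp
  moreover have "(LINT y|lebesgue. h y) = integral\<^sup>L lborel h"
    by (rule integral_completion) simp
  ultimately show ?thesis
    by (simp add: frac_div_def h_def)
qed

text \<open>Fubini moves the kernel from \<open>\<phi>'\<close> to \<open>f\<close>. Up to a
  constant factor, the fractional variation of \<open>f\<close> is thus the total variation of the
  distributional derivative of \<open>riesz_integral \<alpha> f\<close>.\<close>

lemma integral_frac_div: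
  fixes \<alpha> :: real
  assumes \<alpha>: "0 < \<alpha>" "\<alpha> < 1" and f: "integrable lborel f"
  shows "(LINT x|lebesgue. f x * frac_div \<alpha> \<phi> x)
      = frac_const 1 \<alpha> / \<alpha> * (LINT y|lborel. riesz_integral \<alpha> f y * \<phi>' y)"
proof -
  have [measurable]: "f \<in> borel_measurable borel"
    using borel_measurable_integrable[OF f] by simp
  obtain L where L: "0 \<le> L" "\<And>y. \<bar>\<phi>' y\<bar> \<le> L * indicator {-R..R} y"
    using bounds by metis
  note prod = integrable_riesz_product[OF \<alpha> f _ L(1) R L(2), simplified]
  have "(LINT x|lebesgue. f x * frac_div \<alpha> \<phi> x) = (LINT x|lborel. f x * frac_div \<alpha> \<phi> x)"
    by (rule integral_completion) (simp add: frac_div_eq[OF \<alpha>])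
  also have "\<dots> = frac_const 1 \<alpha> / \<alpha> * (LINT x|lborel. LINT y|lborel. f x * \<bar>x - y\<bar> powr (- \<alpha>) * \<phi>' y)"
    by (simp add: frac_div_eq[OF \<alpha>] mult_ac flip: integral_mult_right_zero)
  also have "(LINT x|lborel. LINT y|lborel. f x * \<bar>x - y\<bar> powr (- \<alpha>) * \<phi>' y)
      = (LINT y|lborel. riesz_integral \<alpha> f y * \<phi>' y)"
    using lborel_pair.Fubini_integral[OF prod] by (simp add: riesz_integral_def)
  finally show ?thesis .
qed

end

section \<open>The Riesz integral of a difference of odd powers\<close>

text \<open>Mean value inequality in the centre \<open>t\<close> with
  \<open>\<bar>t\<bar> \<le> m\<close>: there the distance to \<open>x\<close> is at least
  \<open>\<bar>x\<bar> / 2\<close>, and the exponent \<open>p - 1\<close> is nonpositive.\<close>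

lemma abs_powr_diff_bound:
  fixes p x a b m :: real
  assumes "p \<le> 1" "0 < m" "\<bar>a\<bar> \<le> m" "\<bar>b\<bar> \<le> m" "2 * m \<le> \<bar>x\<bar>"
  shows "\<bar>\<bar>x - a\<bar> powr p - \<bar>x - b\<bar> powr p\<bar> \<le> \<bar>p\<bar> * (\<bar>x\<bar> / 2) powr (p - 1) * \<bar>a - b\<bar>"
proof -
  have "norm (\<bar>a - x\<bar> powr p - \<bar>b - x\<bar> powr p) \<le> \<bar>p\<bar> * (\<bar>x\<bar> / 2) powr (p - 1) * norm (a - b)"
  proof (rule field_differentiable_bound[of "{-m..m}"])
    fix t assume t: "t \<in> {-m..m}"
    then have "\<bar>t\<bar> \<le> m" by auto
    then have *: "\<bar>x\<bar> / 2 \<le> \<bar>t - x\<bar>" "t \<noteq> x"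
      using assms abs_triangle_ineq2[of x t] abs_minus_commute[of x t] by auto
    have "((\<lambda>t. \<bar>t - x\<bar> powr p) has_real_derivative p * \<bar>t - x\<bar> powr (p - 1) * sgn (t - x) * 1) (at t)"
      by (rule DERIV_chain2[OF has_real_derivative_abs_powr])
        (use * in \<open>auto intro!: derivative_eq_intros\<close>)
    then show "((\<lambda>t. \<bar>t - x\<bar> powr p) has_real_derivative p * \<bar>t - x\<bar> powr (p - 1) * sgn (t - x) * 1)
        (at t within {-m..m})"
      by (rule has_field_derivative_at_within)
    have "\<bar>t - x\<bar> powr (p - 1) \<le> (\<bar>x\<bar> / 2) powr (p - 1)"
      using assms * by (intro powr_mono2') auto
    then show "norm (p * \<bar>t - x\<bar> powr (p - 1) * sgn (t - x) * 1) \<le> \<bar>p\<bar> * (\<bar>x\<bar> / 2) powr (p - 1)"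
      using * by (simp add: abs_mult abs_sgn_eq mult_left_mono)
  qed (use assms in auto)
  then show ?thesis by (simp add: abs_minus_commute)
qed

text \<open>At every \<open>x\<close> one of the two singularities is at least
  \<open>\<bar>a - b\<bar> / 2\<close> away, so its factor is bounded by a constant, and the product
  is dominated by a sum of single powers.\<close>

lemma integrable_abs_powr_product_Icc:
  fixes a b c d p q :: real
  assumes "a \<noteq> b" "- 1 < p" "p \<le> 0" "- 1 < q" "q \<le> 0"
  shows "integrable lborel (\<lambda>x. indicator {c..d} x * (\<bar>x - a\<bar> powr p * \<bar>x - b\<bar> powr q))"
proof -
  define e where "e = \<bar>a - b\<bar> / 2"
  have e: "0 < e" using assms by (simp add: e_def)
  have bound: "\<bar>x - a\<bar> powr p * \<bar>x - b\<bar> powr q \<le> e powr q * \<bar>x - a\<bar> powr p + e powr p * \<bar>x - b\<bar> powr q" for x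
  proof (cases "e \<le> \<bar>x - a\<bar>")
    case True
    then have "\<bar>x - a\<bar> powr p \<le> e powr p" using e assms by (intro powr_mono2') auto
    then have "\<bar>x - a\<bar> powr p * \<bar>x - b\<bar> powr q \<le> e powr p * \<bar>x - b\<bar> powr q" by (rule mult_right_mono) simp
    then show ?thesis by (simp add: add_increasing)
  next
    case False
    then have "e \<le> \<bar>x - b\<bar>" 
      using abs_triangle_ineq[of "a - x" "x - b"] by (simp add: e_def abs_minus_commute)
    then have "\<bar>x - b\<bar> powr q \<le> e powr q" using e assms by (intro powr_mono2') auto
    then have "\<bar>x - b\<bar> powr q * \<bar>x - a\<bar> powr p \<le> e powr q * \<bar>x - a\<bar> powr p" by (rule mult_right_mono) simp
    then show ?thesis by (simp add: add_increasing2 mult.commute)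
  qed
  have "integrable lborel (\<lambda>x. e powr q * (indicator {c..d} x * \<bar>x - a\<bar> powr p) + e powr p * (indicator {c..d} x * \<bar>x - b\<bar> powr q))"
    using assms by (intro Bochner_Integration.integrable_add integrable_mult_right integrable_abs_diff_powr_Icc)
  then show ?thesis
    by (rule Bochner_Integration.integrable_bound) (use bound in \<open>auto intro!: AE_I2 order_trans[OF _ abs_ge_self] simp: indicator_def\<close>)
qed

section \<open>Odd powers: integrability of differences and against differences of kernels\<close>

definition odd_power :: "real \<Rightarrow> real \<Rightarrow> real" where
  "odd_power \<alpha> x = \<bar>x\<bar> powr (\<alpha> - 1) * sgn x"

lemma measurable_odd_power [measurable]: "odd_power \<alpha> \<in> borel_measurable borel"
  unfolding odd_power_def[abs_def] by measurable

lemma abs_odd_power: "\<bar>odd_power \<alpha> x\<bar> = \<bar>x\<bar> powr (\<alpha> - 1)"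
  by (simp add: odd_power_def abs_mult abs_sgn_eq)

text \<open>Both singularities have exponent \<alpha> - 1 > -1. For \<open>\<bar>x\<bar> > 2\<close>
  the signs agree, and the mean value bound gives decay of order \<alpha> - 2 < -1; the power of 2
  in \<open>?C\<close> comes from \<open>\<bar>x\<bar> / 2\<close> there.\<close>

lemma integrable_odd_power_diff:
  fixes \<alpha> :: real
  assumes \<alpha>: "0 < \<alpha>" "\<alpha> < 1"
  shows "integrable lborel (\<lambda>x. odd_power \<alpha> x - odd_power \<alpha> (x - 1))"
proof -
  let ?C = "(1 - \<alpha>) * 2 powr (2 - \<alpha>)"
  let ?w = "\<lambda>x::real. indicator {-2..2} x * \<bar>x - 0\<bar> powr (\<alpha> - 1) + indicator {-2..2} x * \<bar>x - 1\<bar> powr (\<alpha> - 1)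
      + ?C * (indicator (- {-1<..<1}) x * \<bar>x\<bar> powr (\<alpha> - 2))"
  have w: "integrable lborel ?w"
    using \<alpha> by (intro Bochner_Integration.integrable_add integrable_mult_right integrable_abs_diff_powr_Icc
        integrable_abs_powr_at_infinity) auto
  have bound: "\<bar>odd_power \<alpha> x - odd_power \<alpha> (x - 1)\<bar> \<le> ?w x" for x
  proof (cases "\<bar>x\<bar> \<le> 2")
    case True
    have "\<bar>odd_power \<alpha> x - odd_power \<alpha> (x - 1)\<bar> \<le> \<bar>x\<bar> powr (\<alpha> - 1) + \<bar>x - 1\<bar> powr (\<alpha> - 1)"
      unfolding abs_odd_power[symmetric] by (rule abs_triangle_ineq4)
    also have "\<dots> \<le> ?w x" using True \<alpha> by (auto simp: indicator_def)
    finally show ?thesis .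
  next
    case False
    then have "sgn (x - 1) = sgn x" "x \<noteq> 0" by (auto simp: sgn_if)
    then have "\<bar>odd_power \<alpha> x - odd_power \<alpha> (x - 1)\<bar> = \<bar>\<bar>x - 0\<bar> powr (\<alpha> - 1) - \<bar>x - 1\<bar> powr (\<alpha> - 1)\<bar>"
      by (simp add: odd_power_def abs_mult abs_sgn_eq flip: left_diff_distrib)
    also have "\<dots> \<le> \<bar>\<alpha> - 1\<bar> * (\<bar>x\<bar> / 2) powr (\<alpha> - 1 - 1) * \<bar>0 - 1\<bar>"
      using False \<alpha> by (intro abs_powr_diff_bound[where m = 1]) auto
    also have "\<dots> = ?C * \<bar>x\<bar> powr (\<alpha> - 2)"
      using \<alpha> False by (simp add: powr_divide powr_diff)
    also have "\<dots> \<le> ?w x" using False \<alpha> by (auto simp: indicator_def)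
    finally show ?thesis .
  qed
  show ?thesis
    by (rule Bochner_Integration.integrable_bound[OF w]) (use bound in \<open>auto intro!: AE_I2 order_trans[OF _ abs_ge_self]\<close>)
qed

text \<open>Nonzero \<open>y\<close> and \<open>z\<close> keep the kernel singularities apart from
  the one at 0. At infinity the difference of kernels has order -\<alpha> - 1, so the product has
  order -2.\<close>

lemma integrable_odd_power_kernel:
  fixes \<alpha> y z :: real
  assumes \<alpha>: "0 < \<alpha>" "\<alpha> < 1" and "y \<noteq> 0" "z \<noteq> 0"
  shows "integrable lborel (\<lambda>x. odd_power \<alpha> x * (\<bar>x - y\<bar> powr (- \<alpha>) - \<bar>x - z\<bar> powr (- \<alpha>)))"
proof -
  define m where "m = \<bar>y\<bar> + \<bar>z\<bar>"
  \<comment> \<open>Beyond \<open>2 * m\<close> the mean value bound applies; the extra 1 places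
    \<open>x\<close> where the tail term of \<open>?w\<close> is present.\<close>
  define R where "R = 2 * m + 1"
  let ?C = "\<alpha> * 2 powr (\<alpha> + 1) * \<bar>y - z\<bar>"
  let ?w = "\<lambda>x::real. indicator {-R..R} x * (\<bar>x - 0\<bar> powr (\<alpha> - 1) * \<bar>x - y\<bar> powr (- \<alpha>))
      + indicator {-R..R} x * (\<bar>x - 0\<bar> powr (\<alpha> - 1) * \<bar>x - z\<bar> powr (- \<alpha>))
      + ?C * (indicator (- {-1<..<1}) x * \<bar>x\<bar> powr (- 2))"
  have w: "integrable lborel ?w"
    using assms by (intro Bochner_Integration.integrable_add integrable_mult_right integrable_abs_powr_product_Icc
        integrable_abs_powr_at_infinity) auto
  have m: "0 < m" "\<bar>y\<bar> \<le> m" "\<bar>z\<bar> \<le> m" using assms by (auto simp: m_def)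
  have bound: "\<bar>odd_power \<alpha> x * (\<bar>x - y\<bar> powr (- \<alpha>) - \<bar>x - z\<bar> powr (- \<alpha>))\<bar> \<le> ?w x" for x
  proof (cases "\<bar>x\<bar> \<le> R")
    case True
    have "\<bar>odd_power \<alpha> x * (\<bar>x - y\<bar> powr (- \<alpha>) - \<bar>x - z\<bar> powr (- \<alpha>))\<bar>
        \<le> \<bar>x\<bar> powr (\<alpha> - 1) * (\<bar>x - y\<bar> powr (- \<alpha>) + \<bar>x - z\<bar> powr (- \<alpha>))"
      unfolding abs_mult abs_odd_power
      using abs_triangle_ineq4[of "\<bar>x - y\<bar> powr (- \<alpha>)" "\<bar>x - z\<bar> powr (- \<alpha>)"]
      by (intro mult_left_mono) auto
    also have "\<dots> \<le> ?w x" using True \<alpha> by (auto simp: indicator_def algebra_simps)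
    finally show ?thesis .
  next
    case False
    have "\<bar>odd_power \<alpha> x * (\<bar>x - y\<bar> powr (- \<alpha>) - \<bar>x - z\<bar> powr (- \<alpha>))\<bar>
        \<le> \<bar>x\<bar> powr (\<alpha> - 1) * (\<bar>- \<alpha>\<bar> * (\<bar>x\<bar> / 2) powr (- \<alpha> - 1) * \<bar>y - z\<bar>)"
      unfolding abs_mult abs_odd_power using False \<alpha> m
      by (intro mult_left_mono abs_powr_diff_bound[where m = m]) (auto simp: R_def)
    also have "\<dots> = ?C * (\<bar>x\<bar> powr (\<alpha> - 1) * \<bar>x\<bar> powr (- \<alpha> - 1))"
    proof -
      have "- \<alpha> - 1 = - (\<alpha> + 1)" by simp
      then have "2 powr (- \<alpha> - 1) = inverse (2 powr (\<alpha> + 1) :: real)" by (simp only: powr_minus)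
      moreover have "(\<bar>x\<bar> / 2) powr (- \<alpha> - 1) = \<bar>x\<bar> powr (- \<alpha> - 1) / 2 powr (- \<alpha> - 1)"
        by (rule powr_divide)
      ultimately have "(\<bar>x\<bar> / 2) powr (- \<alpha> - 1) = 2 powr (\<alpha> + 1) * \<bar>x\<bar> powr (- \<alpha> - 1)"
        by (simp only: divide_inverse inverse_inverse_eq mult.commute)
      then show ?thesis using \<alpha> by (simp only: abs_minus_cancel abs_of_pos mult_ac)
    qed
    also have "\<bar>x\<bar> powr (\<alpha> - 1) * \<bar>x\<bar> powr (- \<alpha> - 1) = \<bar>x\<bar> powr (- 2)"
      by (simp flip: powr_add)
    also have "?C * \<bar>x\<bar> powr (- 2) \<le> ?w x" using False \<alpha> m by (auto simp: indicator_def R_def)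
    finally show ?thesis .
  qed
  show ?thesis
    by (rule Bochner_Integration.integrable_bound[OF w]) (use bound in \<open>auto intro!: AE_I2 order_trans[OF _ abs_ge_self]\<close>)
qed

text \<open>The odd power is not integrable against a single kernel \<open>\<bar>x - y\<bar> powr (- \<alpha>)\<close>: the product decays
  only like \<open>1 / x\<close>. A difference of two kernels gains one order of decay.\<close>

definition kernel_difference :: "real \<Rightarrow> real \<Rightarrow> real \<Rightarrow> real" where
  "kernel_difference \<alpha> y z =
    (LINT x|lborel. odd_power \<alpha> x * (\<bar>x - y\<bar> powr (- \<alpha>) - \<bar>x - z\<bar> powr (- \<alpha>)))"

text \<open>Under \<open>x \<mapsto> c * x\<close> the exponents \<alpha> - 1 of the odd power,
  -\<alpha> of the kernels and 1 of the measure add up to 0.\<close>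

lemma kernel_difference_scale:
  assumes "0 < c"
  shows "kernel_difference \<alpha> (c * y) (c * z) = kernel_difference \<alpha> y z"
proof -
  have "odd_power \<alpha> (c * x) * (\<bar>c * x - c * y\<bar> powr (- \<alpha>) - \<bar>c * x - c * z\<bar> powr (- \<alpha>))
      = inverse c * (odd_power \<alpha> x * (\<bar>x - y\<bar> powr (- \<alpha>) - \<bar>x - z\<bar> powr (- \<alpha>)))" for x
  proof -
    have k: "\<bar>c * x - c * y\<bar> powr (- \<alpha>) = c powr (- \<alpha>) * \<bar>x - y\<bar> powr (- \<alpha>)" for y
      using assms by (simp add: abs_mult powr_mult flip: right_diff_distrib)
    have "odd_power \<alpha> (c * x) = c powr (\<alpha> - 1) * odd_power \<alpha> x"
      using assms by (simp add: odd_power_def abs_mult powr_mult sgn_mult)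
    moreover have "c powr (\<alpha> - 1) * c powr (- \<alpha>) = inverse c"
      using assms powr_minus[of c 1] by (simp flip: powr_add)
    ultimately show ?thesis
      unfolding k by (simp add: mult_ac flip: right_diff_distrib)
  qed
  then show ?thesis
    unfolding kernel_difference_def
    using assms by (subst lborel_integral_real_affine[of c _ 0]) simp_all
qed

text \<open>Reflecting \<open>x\<close> changes the sign of the odd power and merely reflects the
  centres of the kernels.\<close>

lemma kernel_difference_neg: "kernel_difference \<alpha> (- y) (- z) = - kernel_difference \<alpha> y z"
proof -
  have "odd_power \<alpha> (- x) * (\<bar>- x + y\<bar> powr (- \<alpha>) - \<bar>- x + z\<bar> powr (- \<alpha>))
      = - (odd_power \<alpha> x * (\<bar>x - y\<bar> powr (- \<alpha>) - \<bar>x - z\<bar> powr (- \<alpha>)))" for x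
    by (simp add: odd_power_def sgn_minus abs_minus_commute)
  then show ?thesis
    unfolding kernel_difference_def
    by (subst lborel_integral_real_affine[of "-1" _ 0]) simp_all
qed

lemma kernel_difference_add:
  assumes "0 < \<alpha>" "\<alpha> < 1" "y \<noteq> 0" "z \<noteq> 0" "w \<noteq> 0"
  shows "kernel_difference \<alpha> y z + kernel_difference \<alpha> z w = kernel_difference \<alpha> y w"
proof -
  let ?h = "\<lambda>y z x. odd_power \<alpha> x * (\<bar>x - y\<bar> powr (- \<alpha>) - \<bar>x - z\<bar> powr (- \<alpha>))"
  have "kernel_difference \<alpha> y z + kernel_difference \<alpha> z w = (LINT x|lborel. ?h y z x + ?h z w x)"
    unfolding kernel_difference_def
    by (rule Bochner_Integration.integral_add[symmetric]; rule integrable_odd_power_kernel; fact)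
  also have "\<dots> = (LINT x|lborel. ?h y w x)"
    by (rule Bochner_Integration.integral_cong[OF refl]) (simp only: flip: distrib_left, simp)
  finally show ?thesis unfolding kernel_difference_def .
qed

lemma kernel_difference_eq_0:
  assumes \<alpha>: "0 < \<alpha>" "\<alpha> < 1" and "0 < y * z"
  shows "kernel_difference \<alpha> y z = 0"
proof -
  have pos: "kernel_difference \<alpha> y z = 0" if "0 < y" "0 < z" for y z
  proof -
    \<comment> \<open>Going from \<open>y\<close> to \<open>z\<close> through \<open>- y\<close> and \<open>- z\<close>, the outer two steps cancel by scaling.\<close>
    let ?Z = "kernel_difference \<alpha>"
    have "?Z y (- y) = ?Z 1 (- 1)" "?Z z (- z) = ?Z 1 (- 1)"
      using kernel_difference_scale[of y \<alpha> 1 "-1"] kernel_difference_scale[of z \<alpha> 1 "-1"] that by simp_all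
    moreover have "?Z y z = ?Z y (- y) + ?Z (- y) (- z) + ?Z (- z) z"
      using that \<alpha> by (simp add: kernel_difference_add)
    moreover have "?Z (- z) z = - ?Z z (- z)" "?Z (- y) (- z) = - ?Z y z"
      using kernel_difference_neg[of \<alpha> z "- z"] by (simp_all add: kernel_difference_neg)
    \<comment> \<open>The middle step is \<open>- ?Z y z\<close>, so \<open>?Z y z\<close> equals
      its own negative.\<close>
    ultimately show ?thesis by simp
  qed
  show ?thesis
  proof (cases "0 < y")
    case True
    with assms show ?thesis by (intro pos) (auto simp: zero_less_mult_iff)
  next
    case False
    with assms have "kernel_difference \<alpha> (- y) (- z) = 0" by (intro pos) (auto simp: zero_less_mult_iff)
    then show ?thesis by (simp add: kernel_difference_neg)
  qed
qed

text \<open>The difference of the two Riesz integrals is one kernel difference minus its translate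
  by 1. Both vanish, because \<open>y\<close> and \<open>z\<close> lie on the same side of 0 and of
  1. The integrability hypotheses exclude default values, so that the integrals may be
  subtracted.\<close>

lemma riesz_integral_odd_power_diff_const:
  fixes \<alpha> y z :: real
  defines "f \<equiv> \<lambda>x. odd_power \<alpha> x - odd_power \<alpha> (x - 1)"
  assumes \<alpha>: "0 < \<alpha>" "\<alpha> < 1" and yz: "0 < y * z" "0 < (y - 1) * (z - 1)"
    and int: "integrable lborel (\<lambda>x. f x * \<bar>x - y\<bar> powr (- \<alpha>))" "integrable lborel (\<lambda>x. f x * \<bar>x - z\<bar> powr (- \<alpha>))"
  shows "riesz_integral \<alpha> f y = riesz_integral \<alpha> f z"
proof -
  have nz: "y \<noteq> 0" "z \<noteq> 0" "y - 1 \<noteq> 0" "z - 1 \<noteq> 0" using yz by auto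
  let ?h = "\<lambda>y z x. odd_power \<alpha> x * (\<bar>x - y\<bar> powr (- \<alpha>) - \<bar>x - z\<bar> powr (- \<alpha>))"
  have h: "integrable lborel (?h y z)" "integrable lborel (\<lambda>x. ?h (y - 1) (z - 1) (x - 1))"
    using integrable_odd_power_kernel[OF \<alpha>] nz
      lborel_integrable_real_affine[OF integrable_odd_power_kernel[OF \<alpha> nz(3,4)], of 1 "- 1"]
    by simp_all
  have "riesz_integral \<alpha> f y - riesz_integral \<alpha> f z
      = (LINT x|lborel. ?h y z x - ?h (y - 1) (z - 1) (x - 1))"
    unfolding riesz_integral_def
    by (subst Bochner_Integration.integral_diff[OF int, symmetric])
      (auto intro!: Bochner_Integration.integral_cong simp: f_def algebra_simps)
  also have "\<dots> = (LINT x|lborel. ?h y z x) - (LINT x|lborel. ?h (y - 1) (z - 1) (x - 1))"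
    by (rule Bochner_Integration.integral_diff[OF h])
  also have "(LINT x|lborel. ?h (y - 1) (z - 1) (x - 1)) = (LINT x|lborel. ?h (y - 1) (z - 1) x)"
    using lborel_integral_real_affine[of 1 "?h (y - 1) (z - 1)" "- 1"] by simp
  finally show ?thesis
    using kernel_difference_eq_0[OF \<alpha>] yz by (simp flip: kernel_difference_def)
qed

section \<open>Smooth step functions\<close>

text \<open>Naming the derivative by an existential, instead of iterating \<open>deriv\<close>,
  makes closure under products and composition a plain induction;
  \<open>differentiable_iterated_deriv\<close> translates back.\<close>

fun times_differentiable :: "nat \<Rightarrow> (real \<Rightarrow> real) \<Rightarrow> bool" where
  "times_differentiable 0 f = True"
| "times_differentiable (Suc k) f =
    (\<exists>f'. (\<forall>x. (f has_real_derivative f' x) (at x)) \<and> times_differentiable k f')"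

lemma times_differentiable_mono: "times_differentiable (Suc k) f \<Longrightarrow> times_differentiable k f"
proof (induction k arbitrary: f)
  case (Suc k)
  then obtain f' where "\<forall>x. (f has_real_derivative f' x) (at x)" "times_differentiable (Suc k) f'"
    by auto
  with Suc.IH show ?case by auto
qed simp

lemma times_differentiable_const: "times_differentiable k (\<lambda>_. c)"
  by (induction k arbitrary: c) (auto intro!: exI[of _ "\<lambda>_. 0"])

lemma times_differentiable_affine: "times_differentiable k (\<lambda>x. a * x + b)"
proof (cases k)
  case (Suc n)
  have "\<forall>x. ((\<lambda>x. a * x + b) has_real_derivative a) (at x)"
    by (auto intro!: derivative_eq_intros)
  with Suc show ?thesis by (auto intro: exI[of _ "\<lambda>_. a"] times_differentiable_const)
qed simp

lemma times_differentiable_add: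
  "times_differentiable k f \<Longrightarrow> times_differentiable k g \<Longrightarrow> times_differentiable k (\<lambda>x. f x + g x)"
proof (induction k arbitrary: f g)
  case (Suc k)
  then obtain f' g' where "\<And>x. (f has_real_derivative f' x) (at x)" "times_differentiable k f'"
    "\<And>x. (g has_real_derivative g' x) (at x)" "times_differentiable k g'"
    by auto
  with Suc.IH show ?case by (auto intro!: exI[of _ "\<lambda>x. f' x + g' x"] DERIV_add)
qed simp

lemma times_differentiable_mult:
  "times_differentiable k f \<Longrightarrow> times_differentiable k g \<Longrightarrow> times_differentiable k (\<lambda>x. f x * g x)"
proof (induction k arbitrary: f g)
  case (Suc k)
  then obtain f' g' where d: "\<And>x. (f has_real_derivative f' x) (at x)" "times_differentiable k f'"
    "\<And>x. (g has_real_derivative g' x) (at x)" "times_differentiable k g'"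
    by auto
  have "times_differentiable k (\<lambda>x. f' x * g x + g' x * f x)"
    by (intro times_differentiable_add Suc.IH d Suc.prems[THEN times_differentiable_mono])
  moreover have "((\<lambda>x. f x * g x) has_real_derivative f' x * g x + g' x * f x) (at x)" for x
    using d by (intro DERIV_mult)
  ultimately show ?case by (auto intro!: exI[of _ "\<lambda>x. f' x * g x + g' x * f x"])
qed simp

lemma times_differentiable_compose:
  "times_differentiable k f \<Longrightarrow> times_differentiable k g \<Longrightarrow> times_differentiable k (\<lambda>x. f (g x))"
proof (induction k arbitrary: f)
  case (Suc k)
  then obtain f' g' where d: "\<And>x. (f has_real_derivative f' x) (at x)" "times_differentiable k f'"
    "\<And>x. (g has_real_derivative g' x) (at x)" "times_differentiable k g'"
    by auto
  have "times_differentiable k (\<lambda>x. f' (g x) * g' x)"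
    by (rule times_differentiable_mult[OF Suc.IH[OF d(2) times_differentiable_mono[OF Suc.prems(2)]] d(4)])
  moreover have "((\<lambda>x. f (g x)) has_real_derivative f' (g x) * g' x) (at x)" for x
    using d by (intro DERIV_chain2)
  ultimately show ?case by (auto intro!: exI[of _ "\<lambda>x. f' (g x) * g' x"])
qed simp

lemma differentiable_iterated_deriv:
  assumes "times_differentiable (Suc k) f"
  shows "(deriv ^^ k) f differentiable (at x)"
  using assms
proof (induction k arbitrary: f)
  case 0
  then show ?case by (auto simp: real_differentiable_def)
next
  case (Suc k)
  then obtain f' where f': "\<forall>x. (f has_real_derivative f' x) (at x)" "times_differentiable (Suc k) f'"
    by auto
  then have "deriv f = f'" by (auto intro: DERIV_imp_deriv)
  with Suc.IH[OF f'(2)] show ?case by (simp add: funpow_Suc_right del: funpow.simps)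
qed

text \<open>Functions of this shape are closed under differentiation; \<open>p = 1\<close> gives the usual flat function.\<close>

definition flat_exp :: "real poly \<Rightarrow> real \<Rightarrow> real" where
  "flat_exp p x = (if 0 < x then poly p (inverse x) * exp (- inverse x) else 0)"

lemma poly_exp_tendsto_0:
  fixes p :: "real poly"
  shows "((\<lambda>t. poly p t * exp (- t)) \<longlongrightarrow> 0) at_top"
proof -
  have "((\<lambda>t::real. t ^ i * exp (- t)) \<longlongrightarrow> 0) at_top" for i :: nat
    using tendsto_power_div_exp_0[of i] by (simp add: exp_minus divide_inverse)
  then have "((\<lambda>t. \<Sum>i\<le>degree p. coeff p i * (t ^ i * exp (- t))) \<longlongrightarrow> (\<Sum>i\<le>degree p. coeff p i * 0)) at_top"
    by (intro tendsto_sum tendsto_mult tendsto_const)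
  then show ?thesis
    by (simp add: poly_altdef sum_distrib_right mult.assoc)
qed

lemma flat_exp_tendsto_0: "(flat_exp p \<longlongrightarrow> 0) (at 0)"
proof -
  have "((\<lambda>x. poly p (inverse x) * exp (- inverse x)) \<longlongrightarrow> 0) (at_right 0)"
    by (rule filterlim_compose[OF poly_exp_tendsto_0 filterlim_inverse_at_top_right])
  then have "(flat_exp p \<longlongrightarrow> 0) (at_right 0)"
    by (rule Lim_transform_eventually) (auto simp: flat_exp_def eventually_at_right_field intro!: exI[of _ 1])
  moreover have "(flat_exp p \<longlongrightarrow> 0) (at_left 0)"
    by (rule tendsto_eventually) (auto simp: flat_exp_def eventually_at_left_field intro!: exI[of _ "-1"])
  ultimately show ?thesis by (simp add: filterlim_split_at)
qed

text \<open>With t = 1/x, differentiating p(t) exp(-t) in x gives t^2 (p(t) - p'(t)) exp(-t). At 0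
  the difference quotient is itself \<open>flat_exp\<close> of t p(t), which tends to 0.\<close>

lemma has_real_derivative_flat_exp:
  "(flat_exp p has_real_derivative flat_exp ([:0, 0, 1:] * (p - pderiv p)) x) (at x)"
proof -
  consider "0 < x" | "x < 0" | "x = 0" by linarith
  then show ?thesis
  proof cases
    case 1
    then have inv: "(inverse has_real_derivative - (inverse x ^ Suc (Suc 0))) (at x)"
      by (intro DERIV_inverse) simp
    have "((\<lambda>x. poly p (inverse x) * exp (- inverse x)) has_real_derivative
        flat_exp ([:0, 0, 1:] * (p - pderiv p)) x) (at x)"
      by (rule DERIV_cong[OF DERIV_mult[OF DERIV_chain2[OF poly_DERIV inv]
              DERIV_chain2[OF DERIV_exp DERIV_minus[OF inv]]]])
        (use 1 in \<open>simp add: flat_exp_def algebra_simps\<close>)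
    then show ?thesis
      by (rule has_field_derivative_transform_within_open[OF _ open_greaterThan[of 0]])
        (use 1 in \<open>auto simp: flat_exp_def\<close>)
  next
    case 2
    have "((\<lambda>x. 0) has_real_derivative flat_exp ([:0, 0, 1:] * (p - pderiv p)) x) (at x)"
      using 2 by (simp add: flat_exp_def)
    then show ?thesis
      by (rule has_field_derivative_transform_within_open[OF _ open_lessThan[of 0]])
        (use 2 in \<open>auto simp: flat_exp_def\<close>)
  next
    case 3
    have "(\<lambda>h. (flat_exp p (0 + h) - flat_exp p 0) / h) = flat_exp ([:0, 1:] * p)"
      by (simp add: fun_eq_iff flat_exp_def divide_inverse)
    moreover have "flat_exp q 0 = 0" for q by (simp add: flat_exp_def)
    ultimately show ?thesis
      unfolding 3 DERIV_def by (simp only: flat_exp_tendsto_0)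
  qed
qed

lemma times_differentiable_flat_exp: "times_differentiable k (flat_exp p)"
  by (induction k arbitrary: p) (use has_real_derivative_flat_exp in auto)

definition flat_exp_1 :: "real \<Rightarrow> real" where "flat_exp_1 = flat_exp 1"

lemma flat_exp_1_mono: "x \<le> y \<Longrightarrow> flat_exp_1 x \<le> flat_exp_1 y"
  by (auto simp: flat_exp_1_def flat_exp_def le_imp_inverse_le)

text \<open>A step from 1 down to 0 across [0, 1] built by composition: \<open>exp (- 1)\<close> is
  the value of \<open>flat_exp_1\<close> at 1, so the outer argument is nonpositive from 1 onwards
  and equals \<open>exp (- 1)\<close> up to 0.\<close>

definition smooth_step :: "real \<Rightarrow> real" where
  "smooth_step x = flat_exp_1 (exp (- 1) - flat_exp_1 x) / flat_exp_1 (exp (- 1))"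

lemma flat_exp_1_pos: "0 < flat_exp_1 (exp (- 1))"
  by (simp add: flat_exp_1_def flat_exp_def)

lemma smooth_step_bounds: "0 \<le> smooth_step x" "smooth_step x \<le> 1"
  and smooth_step_eq_1: "x \<le> 0 \<Longrightarrow> smooth_step x = 1"
  and smooth_step_eq_0: "1 \<le> x \<Longrightarrow> smooth_step x = 0"
  and smooth_step_antimono: "x \<le> y \<Longrightarrow> smooth_step y \<le> smooth_step x"
proof -
  note pos = flat_exp_1_pos
  have nonneg: "0 \<le> flat_exp_1 x" for x by (simp add: flat_exp_1_def flat_exp_def)
  show "0 \<le> smooth_step x"
    using pos nonneg by (simp add: smooth_step_def)
  show "smooth_step x \<le> 1"
    using pos nonneg[of x] by (simp add: smooth_step_def flat_exp_1_mono)
  show "smooth_step x = 1" if "x \<le> 0"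
  proof -
    have "flat_exp_1 x = 0" using that by (simp add: flat_exp_1_def flat_exp_def)
    with pos show ?thesis by (simp add: smooth_step_def)
  qed
  show "smooth_step x = 0" if "1 \<le> x"
  proof -
    have "flat_exp_1 1 \<le> flat_exp_1 x" using that by (rule flat_exp_1_mono)
    then have "exp (- 1) - flat_exp_1 x \<le> 0" by (simp add: flat_exp_1_def flat_exp_def)
    then have "flat_exp_1 (exp (- 1) - flat_exp_1 x) = 0" unfolding flat_exp_1_def flat_exp_def by simp
    then show ?thesis by (simp add: smooth_step_def)
  qed
  show "smooth_step y \<le> smooth_step x" if "x \<le> y"
    unfolding smooth_step_def using pos that
    by (intro divide_right_mono flat_exp_1_mono) (auto simp: flat_exp_1_mono)
qed

lemma times_differentiable_smooth_step: "times_differentiable k smooth_step"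
proof -
  note flat = times_differentiable_flat_exp[of k 1, folded flat_exp_1_def]
  have "times_differentiable k (\<lambda>x. - 1 * flat_exp_1 x + exp (- 1))"
    by (intro times_differentiable_add times_differentiable_mult times_differentiable_const flat)
  from times_differentiable_mult[OF times_differentiable_const times_differentiable_compose[OF flat this],
      of "inverse (flat_exp_1 (exp (- 1)))"]
  show ?thesis
    by (simp add: smooth_step_def[abs_def] divide_inverse mult.commute)
qed

lemma times_differentiable_smooth_step_affine:
  "times_differentiable k (\<lambda>x. smooth_step (a * x + b))"
  by (rule times_differentiable_compose[OF times_differentiable_smooth_step times_differentiable_affine])

section \<open>Fractional variation\<close>

text \<open>A nonempty open interval is not null. This supplies base points at which the Riesz
  integrand is integrable.\<close>

lemma AE_lborel_obtain_between:
  fixes a b :: real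
  assumes "AE y in lborel. P y" "a < b"
  obtains y where "a < y" "y < b" "P y"
proof -
  have "\<exists>y\<in>{a<..<b}. P y"
  proof (rule ccontr)
    assume *: "\<not> (\<exists>y\<in>{a<..<b}. P y)"
    from assms(1) have "AE y in lborel. y \<notin> {a<..<b}"
      by eventually_elim (use * in auto)
    then have "emeasure lborel {a<..<b} = 0"
      by (subst (asm) AE_iff_measurable[where N = "{a<..<b}"]) auto
    with assms(2) show False by simp
  qed
  with that show ?thesis by auto
qed

text \<open>The set where the bound fails is open and null, hence empty. The pointwise bound matters
  because pairings with step functions evaluate \<phi> at single points.\<close>

lemma abs_le_1_of_esssup:
  fixes \<phi> :: "real \<Rightarrow> real"
  assumes "continuous_on UNIV \<phi>" "esssup lebesgue (\<lambda>x. ereal \<bar>\<phi> x\<bar>) \<le> 1"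
  shows "\<bar>\<phi> x\<bar> \<le> 1"
proof (rule ccontr)
  let ?U = "{x. 1 < \<bar>\<phi> x\<bar>}"
  assume "\<not> \<bar>\<phi> x\<bar> \<le> 1"
  then have "?U \<noteq> {}" by (auto intro: exI[of _ x])
  moreover have "open ?U"
    using assms(1) by (intro open_Collect_less continuous_intros)
  moreover have AE: "AE x in lebesgue. x \<notin> ?U"
    using esssup_AE[of "\<lambda>x. ereal \<bar>\<phi> x\<bar>" lebesgue]
  proof eventually_elim
    case (elim x)
    then have "ereal \<bar>\<phi> x\<bar> \<le> 1" using assms(2) by (rule order_trans)
    then show ?case by simp
  qed
  have "negligible ?U"
    unfolding negligible_iff_null_sets
    using \<open>open ?U\<close> by (intro AE_iff_null_sets[THEN iffD2, OF _ AE]) auto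
  ultimately show False using open_not_negligible by blast
qed

section \<open>Test functions and their pairing with step functions\<close>

lemma smooth_compact_support_C1:
  assumes "\<phi> \<in> smooth_compact_support"
  obtains \<phi>' R where "C1_compact \<phi> \<phi>' R"
proof -
  from assms have d: "(deriv ^^ k) \<phi> differentiable (at x)" for k x
    by (auto simp: smooth_compact_support_def)
  have "bounded {x. \<phi> x \<noteq> 0}"
    using assms by (auto simp: smooth_compact_support_def intro: bounded_subset[OF compact_imp_bounded closure_subset])
  then obtain R where R: "\<And>x. \<phi> x \<noteq> 0 \<Longrightarrow> \<bar>x\<bar> \<le> R"
    by (auto simp: bounded_real)
  have "C1_compact \<phi> (deriv \<phi>) (max 0 R)"
  proof
    show "(\<phi> has_real_derivative deriv \<phi> x) (at x)" for x
      using d[of 0 x] by (simp add: DERIV_deriv_iff_real_differentiable)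
    show "continuous_on UNIV (deriv \<phi>)"
      using d[of 1] by (auto intro!: continuous_at_imp_continuous_on differentiable_imp_continuous_within)
    show "\<phi> x = 0" if "max 0 R < \<bar>x\<bar>" for x
      using R[of x] that by fastforce
  qed simp
  then show ?thesis by (rule that)
qed

text \<open>Pairings of \<open>\<phi>'\<close> with the constant 1 and with a unit jump at
  \<open>t\<close>, from which those with all step functions follow.\<close>

lemma (in C1_compact) integral_\<phi>':
  "(LINT y|lborel. \<phi>' y) = 0" (is ?total)
  "(LINT y|lborel. indicator {t<..} y * \<phi>' y) = - \<phi> t" (is ?tail)
proof -
  have FTC: "(LINT y|lborel. \<phi>' y * indicator {a..b} y) = \<phi> b - \<phi> a" if "a \<le> b" for a b
    using that deriv cont by (intro integral_FTC_Icc_real) (auto simp: continuous_on_eq_continuous_at)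
  have "(LINT y|lborel. \<phi>' y) = (LINT y|lborel. \<phi>' y * indicator {- R - 1..R + 1} y)"
    by (rule Bochner_Integration.integral_cong) (auto simp: indicator_def intro!: deriv_supp)
  then show ?total
    using FTC[of "- R - 1" "R + 1"] R by (simp add: supp)
  \<comment> \<open>A point beyond both the support and \<open>t\<close>, so that \<phi> vanishes at
    \<open>b\<close>.\<close>
  define b where "b = max R \<bar>t\<bar> + 1"
  have "(LINT y|lborel. indicator {t<..} y * \<phi>' y) = (LINT y|lborel. \<phi>' y * indicator {t..b} y)"
  proof (rule integral_cong_AE)
    show "AE y in lborel. indicator {t<..} y * \<phi>' y = \<phi>' y * indicator {t..b} y"
      using AE_lborel_singleton[of t]
    proof eventually_elim
      case (elim y)
      have "\<phi>' y = 0" if "b < y"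
        by (rule deriv_supp) (use that in \<open>simp add: b_def\<close>)
      with elim show ?case
        by (cases "b < y") (auto simp: indicator_def)
    qed
  qed auto
  also have "\<dots> = - \<phi> t"
  proof -
    have "R \<le> max R \<bar>t\<bar>" "\<bar>t\<bar> \<le> max R \<bar>t\<bar>" by simp_all
    then have "t \<le> b" "R < \<bar>b\<bar>" unfolding b_def by linarith+
    then show ?thesis using FTC[of t b] supp[of b] by simp
  qed
  finally show ?tail .
qed

lemma frac_const_pos: "\<bar>\<beta>\<bar> < 1 \<Longrightarrow> 0 < frac_const 1 \<beta>"
  by (auto simp: frac_const_def abs_less_iff intro!: mult_pos_pos divide_pos_pos Gamma_real_pos)

text \<open>In effect \<open>- T'\<close> is a probability density carried by [0, 1]: monotonicity
  gives the sign, constancy outside [0, 1] the support, and the total drop the mass.\<close>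

lemma smooth_step_deriv:
  obtains T' L where "\<And>x. (smooth_step has_real_derivative T' x) (at x)" "continuous_on UNIV T'"
    "\<And>x. T' x \<le> 0" "0 \<le> L" "\<And>x. \<bar>T' x\<bar> \<le> L * indicator {0..1} x"
    "(LINT y|lborel. T' y) = - 1"
proof -
  have "times_differentiable (Suc (Suc 0)) smooth_step"
    by (rule times_differentiable_smooth_step)
  then obtain T' T'' where d: "\<And>x. (smooth_step has_real_derivative T' x) (at x)"
    "\<And>x. (T' has_real_derivative T'' x) (at x)"
    by auto
  have cont: "continuous_on UNIV T'"
    using DERIV_isCont[OF d(2)] by (simp add: continuous_at_imp_continuous_on)
  have neg: "T' x \<le> 0" for x
  proof -
    have "mono_on UNIV (\<lambda>x. - smooth_step x)"
      by (auto intro!: mono_onI smooth_step_antimono)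
    then show ?thesis
      using mono_on_imp_deriv_nonneg[OF _ DERIV_minus[OF d(1)], of UNIV x] by simp
  qed
  have supp: "T' x = 0" if "x \<notin> {0..1}" for x
  proof -
    from that consider "x < 0" | "1 < x" by fastforce
    then have "\<exists>c. ((\<lambda>_. c) has_real_derivative T' x) (at x)"
    proof cases
      case 1
      have "((\<lambda>_. 1) has_real_derivative T' x) (at x)"
        by (rule has_field_derivative_transform_within_open[OF d(1) open_lessThan[of 0]])
          (use 1 smooth_step_eq_1 in auto)
      then show ?thesis ..
    next
      case 2
      have "((\<lambda>_. 0) has_real_derivative T' x) (at x)"
        by (rule has_field_derivative_transform_within_open[OF d(1) open_greaterThan[of 1]])
          (use 2 smooth_step_eq_0 in auto)
      then show ?thesis ..
    qed
    then show ?thesis using DERIV_const DERIV_unique by blast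
  qed
  have "bounded (T' ` {0..1})"
    using cont by (auto intro!: compact_imp_bounded compact_continuous_image intro: continuous_on_subset)
  then obtain B where B: "\<And>x. x \<in> {0..1} \<Longrightarrow> \<bar>T' x\<bar> \<le> B"
    unfolding bounded_real by blast
  have bound: "\<bar>T' x\<bar> \<le> \<bar>B\<bar> * indicator {0..1} x" for x
  proof (cases "x \<in> {0..1}")
    case True
    from B[OF this] True show ?thesis by simp
  qed (simp add: supp)
  have "(LINT y|lborel. T' y) = (LINT y|lborel. T' y * indicator {0..1} y)"
    by (rule Bochner_Integration.integral_cong) (use supp in \<open>auto simp: indicator_def\<close>)
  also have "\<dots> = smooth_step 1 - smooth_step 0"
    using d cont by (intro integral_FTC_Icc_real) (auto simp: continuous_on_eq_continuous_at)
  finally have "(LINT y|lborel. T' y) = - 1"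
    by (simp add: smooth_step_eq_1 smooth_step_eq_0)
  with that[OF d(1) cont neg _ bound] show ?thesis by simp
qed

text \<open>For large \<open>a\<close> the test function rises from 0 to 1 on \<open>{1/a..2/a}\<close>, where it picks up the logarithmic
  singularity, and falls back on \<open>{1/4..1/2}\<close>, independently of \<open>a\<close>.\<close>

definition spike_test :: "real \<Rightarrow> real \<Rightarrow> real" where
  "spike_test a y = smooth_step (4 * y - 1) - smooth_step (a * y - 1)"

lemma spike_test_eq_0:
  assumes "2 \<le> a" "1 < \<bar>y\<bar>"
  shows "spike_test a y = 0"
proof (cases "0 < y")
  case True
  then have "2 * 1 \<le> a * y" using assms by (intro mult_mono) auto
  with True assms show ?thesis by (simp add: spike_test_def smooth_step_eq_0)
next
  case False
  then have "a * y \<le> 0" using assms by (intro mult_nonneg_nonpos) auto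
  with False assms show ?thesis by (simp add: spike_test_def smooth_step_eq_1)
qed

lemma spike_test_smooth:
  assumes "2 \<le> a"
  shows "spike_test a \<in> smooth_compact_support"
proof -
  have "times_differentiable (Suc k) (\<lambda>y. smooth_step (4 * y + - 1) + - 1 * smooth_step (a * y + - 1))" for k
    by (intro times_differentiable_add times_differentiable_mult times_differentiable_const
        times_differentiable_smooth_step_affine)
  then have "times_differentiable (Suc k) (spike_test a)" for k
    by (simp add: spike_test_def[abs_def] del: times_differentiable.simps)
  moreover have "bounded {y. spike_test a y \<noteq> 0}"
    unfolding bounded_real using spike_test_eq_0[OF assms] by (metis mem_Collect_eq not_less)
  ultimately show ?thesis
    unfolding smooth_compact_support_def compact_eq_bounded_closed
    by (simp add: differentiable_iterated_deriv bounded_closure del: times_differentiable.simps)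
qed

lemma esssup_spike_test: "esssup lebesgue (\<lambda>x. ereal \<bar>spike_test a x\<bar>) \<le> 1"
proof (rule esssup_I)
  have "isCont smooth_step x" for x
    using times_differentiable_smooth_step[of 1] by (auto intro: DERIV_isCont)
  then have [measurable]: "smooth_step \<in> borel_measurable borel"
    by (intro borel_measurable_continuous_onI continuous_at_imp_continuous_on) simp
  show "(\<lambda>x. ereal \<bar>spike_test a x\<bar>) \<in> borel_measurable lebesgue"
    unfolding spike_test_def by (intro measurable_completion) measurable
  have "\<bar>spike_test a x\<bar> \<le> 1" for x
    using smooth_step_bounds[of "4 * x - 1"] smooth_step_bounds[of "a * x - 1"]
    by (simp add: spike_test_def abs_le_iff)
  then show "AE x in lebesgue. ereal \<bar>spike_test a x\<bar> \<le> 1"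
    by simp
qed

lemma C1_compact_spike_test:
  assumes a: "2 \<le> a" and T': "\<And>x. (smooth_step has_real_derivative T' x) (at x)" "continuous_on UNIV T'"
  shows "C1_compact (spike_test a) (\<lambda>y. 4 * T' (4 * y - 1) - a * T' (a * y - 1)) 1"
proof
  have d: "((\<lambda>y. smooth_step (c * y - 1)) has_real_derivative c * T' (c * x - 1)) (at x)" for c x :: real
  proof -
    have "((\<lambda>y. c * y - 1) has_real_derivative c) (at x)"
      by (auto intro!: derivative_eq_intros)
    from DERIV_chain2[OF T'(1) this] show ?thesis by (simp add: mult.commute)
  qed
  show "(spike_test a has_real_derivative 4 * T' (4 * x - 1) - a * T' (a * x - 1)) (at x)" for x
    unfolding spike_test_def[abs_def] by (intro DERIV_diff d)
  show "continuous_on UNIV (\<lambda>y. 4 * T' (4 * y - 1) - a * T' (a * y - 1))"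
    by (intro continuous_intros continuous_on_compose2[OF T'(2)]) auto
qed (use a spike_test_eq_0 in auto)

section \<open>From the shape of the Riesz integral to the size of the variation\<close>

lemma riesz_integral_cong_AE:
  assumes "AE x in lborel. f x = g x" "f \<in> borel_measurable borel" "g \<in> borel_measurable borel"
  shows "riesz_integral \<alpha> f y = riesz_integral \<alpha> g y"
  unfolding riesz_integral_def
proof (rule integral_cong_AE)
  show "AE x in lborel. f x * \<bar>x - y\<bar> powr (- \<alpha>) = g x * \<bar>x - y\<bar> powr (- \<alpha>)"
    using assms(1) by eventually_elim simp
qed (use assms in measurable)

text \<open>\<open>A\<close>, \<open>B\<close> and \<open>C\<close> are the values at base points in
  the three intervals cut out by 0 and 1, chosen where the integrand is integrable; the coefficients
  are the jumps.\<close>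

lemma AE_riesz_integral_odd_power_diff:
  fixes \<alpha> :: real
  assumes \<alpha>: "0 < \<alpha>" "\<alpha> < 1"
  obtains A B C where "AE y in lborel. riesz_integral \<alpha> (\<lambda>x. odd_power \<alpha> x - odd_power \<alpha> (x - 1)) y
      = A + (B - A) * indicator {0<..} y + (C - B) * indicator {1<..} y"
proof -
  let ?f = "\<lambda>x. odd_power \<alpha> x - odd_power \<alpha> (x - 1)"
  let ?P = "\<lambda>y. integrable lborel (\<lambda>x. ?f x * \<bar>x - y\<bar> powr (- \<alpha>))"
  have P: "AE y in lborel. ?P y"
    by (rule AE_integrable_riesz[OF \<alpha> integrable_odd_power_diff[OF \<alpha>]])
  obtain u where u: "u < 0" "?P u"
    using AE_lborel_obtain_between[OF P, of "-1" 0] by auto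
  obtain v where v: "0 < v" "v < 1" "?P v"
    using AE_lborel_obtain_between[OF P, of 0 1] by auto
  obtain w where w: "1 < w" "?P w"
    using AE_lborel_obtain_between[OF P, of 1 2] by auto
  have "AE y in lborel. riesz_integral \<alpha> ?f y = riesz_integral \<alpha> ?f u
      + (riesz_integral \<alpha> ?f v - riesz_integral \<alpha> ?f u) * indicator {0<..} y
      + (riesz_integral \<alpha> ?f w - riesz_integral \<alpha> ?f v) * indicator {1<..} y"
    using P AE_lborel_singleton[of 0] AE_lborel_singleton[of 1]
  proof eventually_elim
    case (elim y)
    note const = riesz_integral_odd_power_diff_const[OF \<alpha> _ _ elim(1)]
    from elim consider "y < 0" | "0 < y" "y < 1" | "1 < y" by linarith
    then show ?case
    proof cases
      case 1
      have "riesz_integral \<alpha> ?f y = riesz_integral \<alpha> ?f u"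
        using 1 u by (intro const) (auto intro: mult_neg_neg)
      with 1 show ?thesis by simp
    next
      case 2
      have "riesz_integral \<alpha> ?f y = riesz_integral \<alpha> ?f v"
        using 2 v by (intro const) (auto intro: mult_neg_neg)
      with 2 show ?thesis by simp
    next
      case 3
      have "riesz_integral \<alpha> ?f y = riesz_integral \<alpha> ?f w"
        using 3 w by (intro const) auto
      with 3 show ?thesis by simp
    qed
  qed
  then show ?thesis by (rule that)
qed

text \<open>The constant \<open>A\<close> pairs to 0 and the two jumps pair to
  \<open>- B * \<phi> s - C * \<phi> t\<close>, which is at most
  \<open>\<bar>B\<bar> + \<bar>C\<bar>\<close> for every admissible \<phi>.\<close>

lemma BV_frac_I:
  fixes \<alpha> :: real
  assumes \<alpha>: "0 < \<alpha>" "\<alpha> < 1" and f: "integrable lborel f"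
    and step: "AE y in lborel. riesz_integral \<alpha> f y = A + B * indicator {s<..} y + C * indicator {t<..} y"
  shows "f \<in> BV_frac \<alpha>"
proof -
  let ?K = "frac_const 1 \<alpha> / \<alpha> * (\<bar>B\<bar> + \<bar>C\<bar>)"
  have K: "0 \<le> frac_const 1 \<alpha> / \<alpha>" using frac_const_pos[of \<alpha>] \<alpha> by simp
  have [measurable]: "f \<in> borel_measurable borel" using borel_measurable_integrable[OF f] by simp
  have "(LINT x|lebesgue. f x * frac_div \<alpha> \<phi> x) \<le> ?K"
    if \<phi>: "\<phi> \<in> smooth_compact_support" "esssup lebesgue (\<lambda>x. ereal \<bar>\<phi> x\<bar>) \<le> 1" for \<phi>
  proof -
    obtain \<phi>' R where "C1_compact \<phi> \<phi>' R" using smooth_compact_support_C1[OF \<phi>(1)] .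
    then interpret C1_compact \<phi> \<phi>' R .
    have ind: "integrable lborel (\<lambda>y. indicator {s<..} y * \<phi>' y)" for s :: real
      using integrable_real_mult_indicator[OF _ integrable_\<phi>', of "{s<..}"] by (simp add: mult.commute)
    have "(LINT y|lborel. riesz_integral \<alpha> f y * \<phi>' y)
        = (LINT y|lborel. A * \<phi>' y + B * (indicator {s<..} y * \<phi>' y) + C * (indicator {t<..} y * \<phi>' y))"
    proof (rule integral_cong_AE)
      show "AE y in lborel. riesz_integral \<alpha> f y * \<phi>' y
          = A * \<phi>' y + B * (indicator {s<..} y * \<phi>' y) + C * (indicator {t<..} y * \<phi>' y)"
        using step by eventually_elim (simp add: algebra_simps)
    qed (simp_all add: riesz_integral_def)
    also have "\<dots> = - B * \<phi> s - C * \<phi> t"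
      by (simp add: integrable_\<phi>' ind integral_\<phi>')
    also have "\<dots> \<le> \<bar>B\<bar> + \<bar>C\<bar>"
    proof -
      have "\<bar>\<phi> x\<bar> \<le> 1" for x by (rule abs_le_1_of_esssup[OF cont_\<phi> \<phi>(2)])
      then have "\<bar>B\<bar> * \<bar>\<phi> s\<bar> \<le> \<bar>B\<bar> * 1" "\<bar>C\<bar> * \<bar>\<phi> t\<bar> \<le> \<bar>C\<bar> * 1"
        by (intro mult_left_mono; simp)+
      then have "\<bar>B * \<phi> s\<bar> \<le> \<bar>B\<bar>" "\<bar>C * \<phi> t\<bar> \<le> \<bar>C\<bar>" by (simp_all add: abs_mult)
      then show ?thesis by (simp add: abs_le_iff)
    qed
    finally show ?thesis
      unfolding integral_frac_div[OF \<alpha> f] using K by (rule mult_left_mono)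
  qed
  then have "frac_variation \<alpha> f \<le> ereal ?K"
    unfolding frac_variation_def by (intro SUP_least) auto
  then have "frac_variation \<alpha> f < \<infinity>" by (rule order.strict_trans1) simp
  moreover have "integrable lebesgue f" using f by (simp add: integrable_completion)
  ultimately show ?thesis by (simp add: BV_frac_def)
qed

text \<open>The rising flank of \<open>spike_test a\<close> averages the Riesz integral over
  [1/a, 2/a], where it is at least \<open>c * ln (a / 2)\<close>, while the falling flank
  contributes a fixed amount. A finite variation would bound the logarithm.\<close>

lemma not_BV_frac_I:
  fixes \<alpha> c :: real
  assumes \<alpha>: "0 < \<alpha>" "\<alpha> < 1" and f: "integrable lborel f"
    and c: "0 < c" and blowup: "AE y in lborel. 0 < y \<longrightarrow> y < 1 \<longrightarrow> c * ln (1 / y) \<le> riesz_integral \<alpha> f y"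
  shows "f \<notin> BV_frac \<alpha>"
proof
  assume "f \<in> BV_frac \<alpha>"
  then have fin: "frac_variation \<alpha> f < \<infinity>" by (simp add: BV_frac_def)
  define K where "K = real_of_ereal (frac_variation \<alpha> f)"
  define \<mu> where "\<mu> = frac_const 1 \<alpha> / \<alpha>"
  have \<mu>: "0 < \<mu>" using frac_const_pos[of \<alpha>] \<alpha> by (simp add: \<mu>_def)
  obtain T' L where T': "\<And>x. (smooth_step has_real_derivative T' x) (at x)" "continuous_on UNIV T'"
    "\<And>x. T' x \<le> 0" "0 \<le> L" "\<And>x. \<bar>T' x\<bar> \<le> L * indicator {0..1} x"
    "(LINT y|lborel. T' y) = - 1"
    using smooth_step_deriv by blast
  have [measurable]: "T' \<in> borel_measurable borel" "f \<in> borel_measurable borel"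
    using T'(2) borel_measurable_integrable[OF f] by (auto intro: borel_measurable_continuous_onI)
  have [measurable]: "riesz_integral \<alpha> f \<in> borel_measurable borel"
    unfolding riesz_integral_def[abs_def] by measurable
  have int: "integrable lborel (\<lambda>y. riesz_integral \<alpha> f y * T' (a * y - 1))" if a: "2 \<le> a" for a
  proof (rule integrable_riesz_mult[OF \<alpha> f _ T'(4)])
    show "\<bar>T' (a * y - 1)\<bar> \<le> L * indicator {-1..1} y" for y
    proof (cases "y \<in> {-1..1}")
      case False
      have "a * y - 1 \<notin> {0..1}"
      proof (cases "0 < y")
        case True
        then have "2 * y \<le> a * y" using a by (intro mult_right_mono) auto
        moreover have "1 < y" using True False by auto
        ultimately have "1 < a * y - 1" by linarith
        then show ?thesis by auto
      next
        case False
        then have "a * y \<le> 0" using a by (intro mult_nonneg_nonpos) auto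
        then show ?thesis by auto
      qed
      then show ?thesis using T'(5)[of "a * y - 1"] False by simp
    next
      case True
      then have "L * indicator {0..1} (a * y - 1) \<le> L * indicator {-1..1} y"
        using T'(4) by (intro mult_left_mono) (auto simp: indicator_def)
      with T'(5) show ?thesis by (rule order_trans)
    qed
  qed auto
  \<comment> \<open>The falling flank contributes \<open>4 * M\<close>, which is independent of
    \<open>a\<close>.\<close>
  define M where "M = (LINT y|lborel. riesz_integral \<alpha> f y * T' (4 * y - 1))"
  have main: "\<mu> * (4 * M + c * ln (a / 2)) \<le> K" if a: "2 \<le> a" for a
  proof -
    interpret C1_compact "spike_test a" "\<lambda>y. 4 * T' (4 * y - 1) - a * T' (a * y - 1)" 1
      by (rule C1_compact_spike_test[OF a T'(1,2)])
    \<comment> \<open>An integral equal to -1 is not the default value 0, so \<open>T'\<close> is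
      integrable.\<close>
    have T_int: "integrable lborel T'"
      using T'(6) not_integrable_integral_eq by fastforce
    have T_aff: "integrable lborel (\<lambda>y. T' (a * y - 1))" "(LINT y|lborel. T' (a * y - 1)) = - 1 / a"
      using lborel_integrable_real_affine[OF T_int, of a "- 1"] lborel_integral_real_affine[of a T' "- 1"] T'(6) a
      by (auto simp: field_simps)
    have "- c * ln (a / 2) * (- 1 / a) = (LINT y|lborel. - (c * ln (a / 2)) * T' (a * y - 1))"
      using T_aff by simp
    also have "\<dots> \<le> (LINT y|lborel. - (riesz_integral \<alpha> f y * T' (a * y - 1)))"
    proof (rule integral_mono_AE)
      show "AE y in lborel. - (c * ln (a / 2)) * T' (a * y - 1) \<le> - (riesz_integral \<alpha> f y * T' (a * y - 1))"
        \<comment> \<open>For \<open>a = 2\<close> the flank reaches \<open>y = 1\<close>, which the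
          blow-up hypothesis does not cover, so that point is discarded. Since \<open>T'\<close> is
          nonpositive, the lower bound on the Riesz integral turns into the stated
          inequality.\<close>
        using blowup AE_lborel_singleton[of 1]
      proof eventually_elim
        case (elim y)
        show ?case
        proof (cases "a * y - 1 \<in> {0..1}")
          case True
          then have y: "1 \<le> a * y" "a * y \<le> 2" by auto
          then have "0 < y" using a by (smt (verit) mult_nonneg_nonpos)
          moreover have "2 * y \<le> a * y" using a \<open>0 < y\<close> by (intro mult_right_mono) auto
          then have "y < 1" using elim(2) y(2) by linarith
          ultimately have "c * ln (1 / y) \<le> riesz_integral \<alpha> f y" using elim(1) by blast
          moreover have "ln (a / 2) \<le> ln (1 / y)"
            using y a \<open>0 < y\<close> by (subst ln_le_cancel_iff) (auto simp: field_simps)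
          then have "c * ln (a / 2) \<le> c * ln (1 / y)" using c by (intro mult_left_mono) auto
          ultimately have "c * ln (a / 2) \<le> riesz_integral \<alpha> f y" by linarith
          from mult_right_mono_neg[OF this T'(3)] show ?thesis by simp
        next
          case False
          then show ?thesis using T'(5)[of "a * y - 1"] by simp
        qed
      qed
    qed (use T_aff int[OF a] in auto)
    finally have "c * ln (a / 2) \<le> a * (LINT y|lborel. - (riesz_integral \<alpha> f y * T' (a * y - 1)))"
      using a by (simp add: field_simps)
    moreover have "(LINT y|lborel. riesz_integral \<alpha> f y * (4 * T' (4 * y - 1) - a * T' (a * y - 1)))
        = 4 * M - a * (LINT y|lborel. riesz_integral \<alpha> f y * T' (a * y - 1))"
    proof -
      have "(LINT y|lborel. riesz_integral \<alpha> f y * (4 * T' (4 * y - 1) - a * T' (a * y - 1)))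
          = (LINT y|lborel. 4 * (riesz_integral \<alpha> f y * T' (4 * y - 1)) - a * (riesz_integral \<alpha> f y * T' (a * y - 1)))"
        by (simp only: right_diff_distrib mult.left_commute)
      then show ?thesis
        using int[of 4] int[OF a] by (simp add: M_def)
    qed
    ultimately have "4 * M + c * ln (a / 2) \<le> (LINT y|lborel. riesz_integral \<alpha> f y * (4 * T' (4 * y - 1) - a * T' (a * y - 1)))"
      by simp
    then have "\<mu> * (4 * M + c * ln (a / 2)) \<le> (LINT x|lebesgue. f x * frac_div \<alpha> (spike_test a) x)"
      unfolding integral_frac_div[OF \<alpha> f] \<mu>_def[symmetric] using \<mu> by (intro mult_left_mono) auto
    also have "\<dots> \<le> K"
    proof -
      have le: "ereal (LINT x|lebesgue. f x * frac_div \<alpha> (spike_test a) x) \<le> frac_variation \<alpha> f"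
        unfolding frac_variation_def
        by (rule SUP_upper) (simp add: spike_test_smooth[OF a] esssup_spike_test)
      show ?thesis
        using le fin unfolding K_def by (cases "frac_variation \<alpha> f") auto
    qed
    finally show ?thesis .
  qed
  \<comment> \<open>With \<open>a = 2 * exp N\<close>, the term \<open>c * ln (a / 2)\<close> is
    exactly \<open>\<bar>K\<bar> / \<mu> + 4 * \<bar>M\<bar> + 1\<close>, too large for
    \<open>main\<close>.\<close>
  define N where "N = (\<bar>K\<bar> / \<mu> + 4 * \<bar>M\<bar> + 1) / c"
  have N: "0 \<le> N" using c \<mu> by (simp add: N_def)
  have "\<mu> * (4 * M + c * ln (2 * exp N / 2)) \<le> K"
    using N by (intro main) simp
  then have "\<mu> * (4 * M + (\<bar>K\<bar> / \<mu> + 4 * \<bar>M\<bar> + 1)) \<le> K"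
    using c by (simp add: N_def)
  moreover have "\<mu> * (\<bar>K\<bar> / \<mu> + 1) \<le> \<mu> * (4 * M + (\<bar>K\<bar> / \<mu> + 4 * \<bar>M\<bar> + 1))"
    using \<mu> by (intro mult_left_mono) auto
  moreover have "\<mu> * (\<bar>K\<bar> / \<mu> + 1) = \<bar>K\<bar> + \<mu>"
    using \<mu> by (simp add: field_simps)
  ultimately show False using \<mu> by linarith
qed

text \<open>For \<open>y < x < 1\<close> the kernel is at least \<open>x powr (- \<alpha>)\<close>,
  so the integrand is at least \<open>c / x\<close>, whose integral over [y, 1] is the logarithm.
  Elsewhere it is nonnegative. Integrability excludes the default value 0.\<close>

lemma riesz_integral_blowup:
  fixes \<alpha> c y :: real
  assumes f: "\<And>x. 0 < x \<Longrightarrow> x < 1 \<Longrightarrow> c * x powr (\<alpha> - 1) \<le> f x" "\<And>x. 0 \<le> f x"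
    and \<alpha>: "0 < \<alpha>" and c: "0 < c" and y: "0 < y" "y < 1"
    and int: "integrable lborel (\<lambda>x. f x * \<bar>x - y\<bar> powr (- \<alpha>))"
  shows "c * ln (1 / y) \<le> riesz_integral \<alpha> f y"
proof -
  have FTC: "has_bochner_integral lborel (\<lambda>x. c / x * indicator {y..1} x) (c * ln 1 - c * ln y)"
    using y by (intro has_bochner_integral_FTC_Icc_real) (auto intro!: derivative_eq_intros continuous_intros)
  have "c * ln (1 / y) = (LINT x|lborel. c / x * indicator {y..1} x)"
    using has_bochner_integral_integral_eq[OF FTC] y by (simp add: ln_div)
  also have "\<dots> \<le> riesz_integral \<alpha> f y"
    unfolding riesz_integral_def
  proof (rule integral_mono_AE)
    show "integrable lborel (\<lambda>x. c / x * indicator {y..1} x)"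
      using FTC by (simp add: has_bochner_integral_iff)
    show "AE x in lborel. c / x * indicator {y..1} x \<le> f x * \<bar>x - y\<bar> powr (- \<alpha>)"
      using AE_lborel_singleton[of y] AE_lborel_singleton[of 1]
    proof eventually_elim
      case (elim x)
      show ?case
      proof (cases "x \<in> {y..1}")
        case True
        then have x: "y < x" "0 < x" "x < 1" using elim y by auto
        have "x powr (- \<alpha>) \<le> (x - y) powr (- \<alpha>)"
          using x y \<alpha> by (intro powr_mono2') auto
        then have "(c * x powr (\<alpha> - 1)) * x powr (- \<alpha>) \<le> f x * (x - y) powr (- \<alpha>)"
          using f x c by (intro mult_mono) auto
        moreover have "x powr (\<alpha> - 1) * x powr (- \<alpha>) = x powr (- 1)"
          by (simp flip: powr_add)
        moreover have "x powr (- 1) = inverse x"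
          using x powr_minus[of x 1] by simp
        ultimately show ?thesis
          using x True by (simp add: divide_inverse mult.assoc)
      qed (use f in simp)
    qed
  qed (rule int)
  finally show ?thesis .
qed

theorem theorem1p1:
  fixes \<alpha> :: real and f :: "real \<Rightarrow> real"
  assumes "\<alpha> \<in> {0<..<1}"
    and "\<And>x. x \<in> UNIV - {0, 1} \<Longrightarrow>
           f x = frac_const 1 (- \<alpha>) *
             (\<bar>x\<bar> powr (\<alpha> - 1) * sgn x - \<bar>x - 1\<bar> powr (\<alpha> - 1) * sgn (x - 1))"
  shows "f \<in> BV_frac \<alpha> \<and> (\<lambda>x. \<bar>f x\<bar>) \<notin> BV_frac \<alpha>"
proof -
  have \<alpha>: "0 < \<alpha>" "\<alpha> < 1" using assms(1) by auto
  define c where "c = frac_const 1 (- \<alpha>)"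
  have c: "0 < c" unfolding c_def using \<alpha> by (intro frac_const_pos) auto
  let ?g = "\<lambda>x. odd_power \<alpha> x - odd_power \<alpha> (x - 1)"
  have f_eq: "f x = c * ?g x" if "x \<noteq> 0" "x \<noteq> 1" for x
    using assms(2)[of x] that by (simp add: odd_power_def c_def)
  have AE_eq: "AE x in lborel. f x = c * ?g x"
    using AE_lborel_singleton[of 0] AE_lborel_singleton[of 1]
    by eventually_elim (rule f_eq)
  \<comment> \<open>The values of \<open>f\<close> at 0 and 1 are arbitrary; splitting them off
    shows Borel measurability.\<close>
  have "f = (\<lambda>x. if x = 0 then f 0 else if x = 1 then f 1 else c * ?g x)"
    using f_eq by auto
  also have "\<dots> \<in> borel_measurable borel"
    by measurable
  finally have [measurable]: "f \<in> borel_measurable borel" .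
  have g: "integrable lborel (\<lambda>x. c * ?g x)"
    by (intro integrable_mult_right integrable_odd_power_diff \<alpha>)
  then have f: "integrable lborel f"
    using AE_eq by (subst integrable_cong_AE) auto
  obtain A B C where "AE y in lborel. riesz_integral \<alpha> ?g y
      = A + (B - A) * indicator {0<..} y + (C - B) * indicator {1<..} y"
    by (rule AE_riesz_integral_odd_power_diff[OF \<alpha>])
  then have "AE y in lborel. riesz_integral \<alpha> f y
      = c * A + c * (B - A) * indicator {0<..} y + c * (C - B) * indicator {1<..} y"
  proof eventually_elim
    case (elim y)
    have "riesz_integral \<alpha> f y = riesz_integral \<alpha> (\<lambda>x. c * ?g x) y"
      by (rule riesz_integral_cong_AE[OF AE_eq]) measurable
    also have "\<dots> = c * riesz_integral \<alpha> ?g y"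
      by (simp only: riesz_integral_def mult.assoc integral_mult_right_zero)
    finally show ?case unfolding elim by (simp add: algebra_simps)
  qed
  then have "f \<in> BV_frac \<alpha>"
    by (rule BV_frac_I[OF \<alpha> f])
  moreover have "(\<lambda>x. \<bar>f x\<bar>) \<notin> BV_frac \<alpha>"
  proof (rule not_BV_frac_I[OF \<alpha> integrable_abs[OF f] c])
    \<comment> \<open>On (0, 1) the two terms of \<open>f\<close> are both positive, so the first
      alone is a lower bound. To the left of 0 the function \<open>f\<close> is negative, and taking
      the absolute value removes the cancellation from there.\<close>
    have lower: "c * x powr (\<alpha> - 1) \<le> \<bar>f x\<bar>" if "0 < x" "x < 1" for x
    proof -
      have "f x = c * (x powr (\<alpha> - 1) + (1 - x) powr (\<alpha> - 1))"
        using that by (simp add: f_eq odd_power_def)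
      moreover have "c * x powr (\<alpha> - 1) \<le> c * (x powr (\<alpha> - 1) + (1 - x) powr (\<alpha> - 1))"
        using c by (intro mult_left_mono) auto
      ultimately show ?thesis by linarith
    qed
    show "AE y in lborel. 0 < y \<longrightarrow> y < 1 \<longrightarrow> c * ln (1 / y) \<le> riesz_integral \<alpha> (\<lambda>x. \<bar>f x\<bar>) y"
      using AE_integrable_riesz[OF \<alpha> integrable_abs[OF f]]
      by eventually_elim (use riesz_integral_blowup[OF lower _ \<alpha>(1) c] in auto)
  qed
  ultimately show ?thesis ..
qed

end
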